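(* Let $B=K_{\aleph_0}$ be the countably infinite complete graph and let $c\colon E(B)\to\{1,2\}$ be a coloring of its edges. If the graph induced by $c^{-1}(\{1\})$ or the graph induced by $c^{-1}(\{2\})$ has finite maximum degree (i.e. there is a finite bound on all its vertex degrees), then Breaker has a winning strategy in the game $\mathrm{MB}_{\mathrm{col}}(2,c)$. Otherwise, Maker has a winning strategy in $\mathrm{MB}_{\mathrm{col}}(2,c)$.
   Context: Two players, Maker and Breaker, alternately claim previously unclaimed edges of $B=K_{\aleph_0}$, one edge per move; Maker moves first and the game lasts $\omega$ moves. For $k\in\mathbb N$ and a coloring $c\colon E(B)\to\{1,\dots,k\}$, Maker wins the game $\mathrm{MB}_{\mathrm{col}}(k,c)$ if there is a copy $K\subseteq B$ of $K_{\aleph_0}$ (an infinite complete subgraph) all of whose edges have been claimed by Maker during the game, such that $K$ contains infinitely many edges of each color, i.e. $|c^{-1}(\{i\})\cap E(K)|=\aleph_0$ for all $i\in\{1,\dots,k\}$. Otherwise Breaker wins. *)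

theory Defs
  imports Main "HOL-Library.FuncSet" "HOL-Library.Ramsey"
begin

section \<open>The graph $K_{\aleph_0}$ and degrees\<close>

type_synonym edge = "nat set"

definition edges_B :: "edge set" where
  "edges_B = nsets UNIV 2"

definition color_class :: "(edge \<Rightarrow> nat) \<Rightarrow> nat \<Rightarrow> edge set" where
  "color_class c i = {e \<in> edges_B. c e = i}"

definition incident_edges :: "edge set \<Rightarrow> nat \<Rightarrow> edge set" where
  "incident_edges F v = {e \<in> F. v \<in> e}"

text \<open>
  The graph induced by an edge set \<open>F\<close> has vertex set \<open>\<Union>F\<close>. Finiteness is required
  explicitly because \<^const>\<open>card\<close> is \<open>0\<close> on infinite sets.
\<close>

definition finite_max_degree :: "edge set \<Rightarrow> bool" where
  "finite_max_degree F \<longleftrightarrow>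
     (\<exists>d::nat. \<forall>v \<in> \<Union>F. finite (incident_edges F v) \<and> card (incident_edges F v) \<le> d)"

section \<open>The game\<close>

text \<open>
  A position is the list of the edges claimed so far, in order of play. Moves are numbered
  from 0 and Maker moves first, so Maker makes the moves with even number and is to move
  at positions of even length.
\<close>

definition position :: "edge list \<Rightarrow> bool" where
  "position h \<longleftrightarrow> distinct h \<and> set h \<subseteq> edges_B"

definition play :: "(nat \<Rightarrow> edge) \<Rightarrow> bool" where
  "play p \<longleftrightarrow> inj p \<and> range p \<subseteq> edges_B"

definition claimed_by_Maker :: "(nat \<Rightarrow> edge) \<Rightarrow> edge set" where
  "claimed_by_Maker p = p ` {n. even n}"

definition Maker_wins_play :: "nat \<Rightarrow> (edge \<Rightarrow> nat) \<Rightarrow> (nat \<Rightarrow> edge) \<Rightarrow> bool" where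
  "Maker_wins_play k c p \<longleftrightarrow>
     (\<exists>A::nat set. infinite A \<and> nsets A 2 \<subseteq> claimed_by_Maker p \<and>
        (\<forall>i \<in> {1..k}. infinite (color_class c i \<inter> nsets A 2)))"

definition Maker_strategy :: "(edge list \<Rightarrow> edge) \<Rightarrow> bool" where
  "Maker_strategy s \<longleftrightarrow>
     (\<forall>h. position h \<and> even (length h) \<longrightarrow> s h \<in> edges_B - set h)"

definition Breaker_strategy :: "(edge list \<Rightarrow> edge) \<Rightarrow> bool" where
  "Breaker_strategy s \<longleftrightarrow>
     (\<forall>h. position h \<and> odd (length h) \<longrightarrow> s h \<in> edges_B - set h)"

definition Maker_follows :: "(edge list \<Rightarrow> edge) \<Rightarrow> (nat \<Rightarrow> edge) \<Rightarrow> bool" where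
  "Maker_follows s p \<longleftrightarrow> (\<forall>n. even n \<longrightarrow> p n = s (map p [0..<n]))"

definition Breaker_follows :: "(edge list \<Rightarrow> edge) \<Rightarrow> (nat \<Rightarrow> edge) \<Rightarrow> bool" where
  "Breaker_follows s p \<longleftrightarrow> (\<forall>n. odd n \<longrightarrow> p n = s (map p [0..<n]))"

definition Maker_has_winning_strategy :: "nat \<Rightarrow> (edge \<Rightarrow> nat) \<Rightarrow> bool" where
  "Maker_has_winning_strategy k c \<longleftrightarrow>
     (\<exists>s. Maker_strategy s \<and>
        (\<forall>p. play p \<and> Maker_follows s p \<longrightarrow> Maker_wins_play k c p))"

definition Breaker_has_winning_strategy :: "nat \<Rightarrow> (edge \<Rightarrow> nat) \<Rightarrow> bool" where
  "Breaker_has_winning_strategy k c \<longleftrightarrow>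
     (\<exists>s. Breaker_strategy s \<and>
        (\<forall>p. play p \<and> Breaker_follows s p \<longrightarrow> \<not> Maker_wins_play k c p))"

end

theory Submission
  imports Defs
begin

text \<open>
  If some colour class has bounded degree, label the vertices with finitely many labels such that
  any two neighbours of a vertex in this class have different labels, and pair the edge \<open>{x, y}\<close>
  with \<open>{x', y'}\<close>, where \<open>x'\<close> is the neighbour of \<open>x\<close> labelled like \<open>y\<close> and \<open>y'\<close> the neighbour of \<open>y\<close>
  labelled like \<open>x\<close>. Breaker answers every edge by its partner. Two edges \<open>{x, x'}\<close>, \<open>{y, y'}\<close> of
  this colour with the same labels have the paired cross edges \<open>{x, y'}\<close>, \<open>{x', y}\<close>, so a complete
  graph claimed by Maker contains at most one of them for each pair of labels.

  Otherwise Maker grows a tree of branching at most 4 in which any two vertices on a common branch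
  are joined by her edges; by Koenig's lemma an infinite branch is a complete graph. A vertex \<open>x\<close>
  can be joined to at least two children of each full node by a pairing argument on the four
  children. Afterwards a vertex \<open>y\<close> can be joined to \<open>x\<close> and to one of these two children for each
  full node, hence to a path from the root to a node that is not full. With sufficiently many \<open>y\<close> at
  least four of them end at the same node, which can be extended by \<open>x\<close> and four children of
  \<open>x\<close>. So Maker can put infinitely many edges of prescribed large stars into her complete graph.

  By Ramsey's theorem either both colours have infinite homogeneous sets, and stars from one to the
  other suffice, or one colour is unavoidable in every infinite complete graph. In the latter case
  the stars are taken in the other colour if it is locally finite, and else a vertex \<open>u\<close> of infinite
  degree in that colour takes the role of \<open>x\<close> throughout, with all other vertices among its
  neighbours.
\<close>

section \<open>Forcing and strategies\<close>

text \<open>A goal is a game of finite length, written with alternating quantifiers over single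
  moves; strategy functions for Maker first appear in \<open>strategy_from_forces\<close>. The
  number of rounds is exact, so that goals can be chained by adding these numbers.\<close>

primrec forces :: "nat \<Rightarrow> (edge list \<Rightarrow> bool) \<Rightarrow> edge list \<Rightarrow> bool" where
  "forces 0 Q h \<longleftrightarrow> Q h"
| "forces (Suc n) Q h \<longleftrightarrow>
     (\<exists>e \<in> edges_B - set h. \<forall>f \<in> edges_B - insert e (set h). forces n Q (h @ [e, f]))"

definition maker_edges :: "edge list \<Rightarrow> edge set" where
  "maker_edges h = {h ! i |i. i < length h \<and> even i}"

lemma maker_edges_append: "maker_edges h \<subseteq> maker_edges (h @ t)"
proof
  fix e assume "e \<in> maker_edges h"
  then obtain i where "i < length h" "even i" "e = h ! i" by (auto simp: maker_edges_def)
  then show "e \<in> maker_edges (h @ t)"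
    unfolding maker_edges_def by (auto simp: nth_append intro!: exI[of _ i])
qed

lemma maker_edges_round: "even (length h) \<Longrightarrow> e \<in> maker_edges (h @ [e, f] @ t)"
  unfolding maker_edges_def by (auto simp: nth_append intro!: exI[of _ "length h"])

lemma forces_add: "forces m (forces n Q) h \<Longrightarrow> forces (m + n) Q h"
  by (induction m arbitrary: h) auto

lemma position_round:
  "position h \<Longrightarrow> e \<in> edges_B - set h \<Longrightarrow> f \<in> edges_B - insert e (set h) \<Longrightarrow> position (h @ [e, f])"
  by (auto simp: position_def)

text \<open>\<open>R\<close> has to be checked only at legal positions exactly \<open>n\<close>
  rounds later. The exact length is what later bounds the number of touched vertices.\<close>

lemma forces_mono:
  assumes "forces n Q h" "position h"
    and "\<And>t. position (h @ t) \<Longrightarrow> length t = 2 * n \<Longrightarrow> Q (h @ t) \<Longrightarrow> R (h @ t)"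
  shows "forces n R h"
  using assms
proof (induction n arbitrary: h)
  case 0
  then show ?case using "0.prems"(3)[of "[]"] by simp
next
  case (Suc n)
  then obtain e where e: "e \<in> edges_B - set h"
    and f: "\<And>f. f \<in> edges_B - insert e (set h) \<Longrightarrow> forces n Q (h @ [e, f])" by auto
  have "forces n R (h @ [e, f])" if "f \<in> edges_B - insert e (set h)" for f
  proof (rule Suc.IH[OF f[OF that] position_round[OF Suc.prems(2) e that]])
    fix t assume "position ((h @ [e, f]) @ t)" "length t = 2 * n" "Q ((h @ [e, f]) @ t)"
    then show "R ((h @ [e, f]) @ t)" using Suc.prems(3)[of "e # f # t"] by simp
  qed
  with e show ?case by auto
qed

lemma forces_seq:
  assumes "forces m Q h" "position h"
    and "\<And>t. position (h @ t) \<Longrightarrow> length t = 2 * m \<Longrightarrow> Q (h @ t) \<Longrightarrow> forces n R (h @ t)"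
  shows "forces (m + n) R h"
  using forces_add forces_mono[OF assms(1,2), of "forces n R"] assms(3) by blast

section \<open>Hitting pairwise disjoint sets of edges\<close>

text \<open>
  The exceptional index \<open>i0\<close> is the set that Maker has to hit immediately, because Breaker has left
  a single edge of it. As the sets are disjoint, Breaker endangers at most one set in each move.
\<close>

lemma forces_hit:
  assumes "finite I" "even (length h)" "position h"
    and "\<forall>i\<in>I. A i \<subseteq> edges_B - set h \<and> A i \<noteq> {}"
    and "\<forall>i\<in>I. \<forall>j\<in>I. i \<noteq> j \<longrightarrow> A i \<inter> A j = {}"
    and "\<forall>i\<in>I. i \<noteq> i0 \<longrightarrow> (\<forall>e. \<not> A i \<subseteq> {e})"
  shows "forces (card I) (\<lambda>h'. \<forall>i\<in>I. A i \<inter> maker_edges h' \<noteq> {}) h"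
  using assms
proof (induction "card I" arbitrary: I A i0 h)
  case 0
  then show ?case by simp
next
  case (Suc n)
  then have "I \<noteq> {}" by auto
  then obtain i where i: "i \<in> I" "i0 \<in> I \<Longrightarrow> i = i0" by auto
  then obtain e where e: "e \<in> A i" using Suc.prems by blast
  have eB: "e \<in> edges_B - set h" using e i Suc.prems(4) by blast
  have "forces n (\<lambda>h'. \<forall>i\<in>I. A i \<inter> maker_edges h' \<noteq> {}) (h @ [e, f])"
    if f: "f \<in> edges_B - insert e (set h)" for f
  proof -
    \<comment> \<open>The set from which Breaker's answer \<open>f\<close> takes an edge, unique by
      disjointness, becomes the exceptional index for the remaining sets \<open>A j - {f}\<close>.
      If there is no such set, \<open>j0\<close> is arbitrary.\<close>
    define j0 where "j0 = (SOME j. j \<in> I - {i} \<and> f \<in> A j)"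
    have j0: "f \<notin> A j" if "j \<in> I - {i}" "j \<noteq> j0" for j
    proof
      assume a: "f \<in> A j"
      then have "j0 \<in> I - {i} \<and> f \<in> A j0" unfolding j0_def using that by (metis (mono_tags, lifting) someI_ex)
      with a that Suc.prems(5) show False by blast
    qed
    have big: "\<not> A j \<subseteq> {e}" if "j \<in> I - {i}" for j e
      using that Suc.prems(6) i by (metis DiffD1 DiffD2 insertI1)
    have n: "n = card (I - {i})" using Suc(2) i Suc.prems(1) by simp
    have "forces (card (I - {i}))
            (\<lambda>h'. \<forall>j\<in>I - {i}. (A j - {f}) \<inter> maker_edges h' \<noteq> {}) (h @ [e, f])"
    proof (rule Suc.hyps(1)[OF n, where ?i0.0 = j0])
      show "position (h @ [e, f])" using position_round[OF Suc.prems(3) eB f] .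
      show "\<forall>j\<in>I - {i}. A j - {f} \<subseteq> edges_B - set (h @ [e, f]) \<and> A j - {f} \<noteq> {}"
      proof
        fix j assume j: "j \<in> I - {i}"
        then have "e \<notin> A j" using Suc.prems(5) i e by blast
        with j big[OF j, of f] Suc.prems(4)
        show "A j - {f} \<subseteq> edges_B - set (h @ [e, f]) \<and> A j - {f} \<noteq> {}" by auto
      qed
      show "\<forall>j\<in>I - {i}. \<forall>k\<in>I - {i}. j \<noteq> k \<longrightarrow> (A j - {f}) \<inter> (A k - {f}) = {}"
        using Suc.prems(5) by blast
      show "\<forall>j\<in>I - {i}. j \<noteq> j0 \<longrightarrow> (\<forall>e. \<not> A j - {f} \<subseteq> {e})"
        using j0 big by simp
    qed (use Suc.prems in auto)
    then show ?thesis unfolding n[symmetric]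
    proof (rule forces_mono)
      show "position (h @ [e, f])" using position_round[OF Suc.prems(3) eB f] .
      fix t
      assume *: "\<forall>j\<in>I - {i}. (A j - {f}) \<inter> maker_edges ((h @ [e, f]) @ t) \<noteq> {}"
      have "e \<in> maker_edges ((h @ [e, f]) @ t)" using maker_edges_round[OF Suc.prems(2)] by simp
      with * e show "\<forall>i\<in>I. A i \<inter> maker_edges ((h @ [e, f]) @ t) \<noteq> {}" by blast
    qed
  qed
  with eB show ?case unfolding Suc(2)[symmetric] by auto
qed

section \<open>From forced goals to strategies in the infinite game\<close>

lemma infinite_edges_B: "infinite edges_B"
  unfolding edges_B_def by (rule infinite_imp_infinite_nsets) simp_all

lemma unclaimed_exists: "\<exists>e. e \<in> edges_B - set h"
  using infinite_edges_B by (metis List.finite_set ex_in_conv finite.emptyI infinite_remove finite_Diff2)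

lemma position_play: "play p \<Longrightarrow> position (map p [0..<n])"
  unfolding play_def position_def by (auto simp: distinct_map intro: inj_on_subset)

lemma maker_edges_play: "maker_edges (map p [0..<n]) \<subseteq> claimed_by_Maker p"
  unfolding maker_edges_def claimed_by_Maker_def by auto

text \<open>
  The memory of a strategy: the current state \<open>K\<close> and the number of rounds until the next state is
  reached. The history is reversed, so that the last round comes first.
\<close>

fun script :: "('s \<Rightarrow> edge list \<Rightarrow> nat) \<Rightarrow> ('s \<Rightarrow> edge list \<Rightarrow> 's) \<Rightarrow> 's \<Rightarrow> edge list \<Rightarrow> 's \<times> nat" where
  "script N nxt K0 (f # e # g) =
     (case script N nxt K0 g of (K, n) \<Rightarrow>
        if n = 1 then let K' = nxt K (rev (f # e # g)) in (K', N K' (rev (f # e # g)))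
        else (K, n - 1))"
| "script N nxt K0 g = (K0, N K0 [])"

text \<open>From every state Maker can force a \<open>G\<close>-successor, so she pursues these
  finite goals one after another. Her move may depend on the history only, from which
  \<open>script\<close> recovers the current state and the countdown.\<close>

theorem strategy_from_forces:
  fixes Inv :: "'s \<Rightarrow> edge list \<Rightarrow> bool" and G :: "'s \<Rightarrow> 's \<Rightarrow> bool"
  assumes "Inv K0 []"
    and step: "\<And>K h. Inv K h \<Longrightarrow> position h \<Longrightarrow> even (length h) \<Longrightarrow>
       \<exists>n>0. forces n (\<lambda>h'. \<exists>K'. G K K' \<and> Inv K' h') h"
  obtains s where "Maker_strategy s"
    and "\<And>p. play p \<Longrightarrow> Maker_follows s p \<Longrightarrow>
       \<exists>K. \<forall>j. G (K j) (K (Suc j)) \<and> (\<exists>n. Inv (K j) (map p [0..<n]))"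
proof -
  define Q where "Q K h' \<longleftrightarrow> (\<exists>K'. G K K' \<and> Inv K' h')" for K h'
  define N where "N K h = (SOME n. n > 0 \<and> forces n (Q K) h)" for K h
  define nxt where "nxt K h = (SOME K'. G K K' \<and> Inv K' h)" for K h
  define st where "st h = script N nxt K0 (rev h)" for h
  \<comment> \<open>A move is good if the goal stays forced in one round less, whatever Breaker
    answers.\<close>
  define good where "good h e \<longleftrightarrow> e \<in> edges_B - set h \<and>
    (\<forall>f \<in> edges_B - insert e (set h). forces (snd (st h) - 1) (Q (fst (st h))) (h @ [e, f]))" for h e
  \<comment> \<open>Where no good move exists, any unclaimed edge serves, so that the strategy is
    legal at every position.\<close>
  define s where "s h = (if \<exists>e. good h e then SOME e. good h e else SOME e. e \<in> edges_B - set h)" for h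
  have N: "N K h > 0 \<and> forces (N K h) (Q K) h" if "Inv K h" "position h" "even (length h)" for K h
    unfolding N_def using someI_ex[OF step[OF that, folded Q_def], simplified] by simp
  have nxt: "G K (nxt K h) \<and> Inv (nxt K h) h" if "Q K h" for K h
    using that unfolding Q_def nxt_def by (rule someI_ex)
  have s_good: "good h (s h)" if "\<exists>e. good h e" for h
    using that someI_ex[OF that] by (simp add: s_def)
  have strat: "Maker_strategy s"
    unfolding Maker_strategy_def
  proof (intro allI impI)
    fix h :: "edge list"
    show "s h \<in> edges_B - set h"
    proof (cases "\<exists>e. good h e")
      case True
      then show ?thesis using s_good good_def by blast
    next
      case False
      then show ?thesis using someI_ex[OF unclaimed_exists] by (simp add: s_def)
    qed
  qed
  have "\<exists>K. \<forall>j. G (K j) (K (Suc j)) \<and> (\<exists>n. Inv (K j) (map p [0..<n]))"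
    if p: "play p" "Maker_follows s p" for p
  proof -
    define P where "P m = map p [0..<2 * m]" for m
    define K where "K m = fst (st (P m))" for m
    define n where "n m = snd (st (P m))" for m
    have pos: "position (P m)" "even (length (P m))" for m
      using position_play[OF p(1)] by (simp_all add: P_def)
    have P_Suc: "P (Suc m) = P m @ [p (2 * m), p (Suc (2 * m))]" for m by (simp add: P_def)
    have st_Suc: "st (P (Suc m)) = (if n m = 1
        then (nxt (K m) (P (Suc m)), N (nxt (K m) (P (Suc m))) (P (Suc m))) else (K m, n m - 1))" for m
      unfolding K_def n_def P_Suc st_def by (auto simp: Let_def split: prod.split)
    \<comment> \<open>The invariant along a play: the countdown is positive, the next state is
      forced within exactly that many rounds, and the current state was realised at some stage of
      the play.\<close>
    define J where "J m \<longleftrightarrow> n m > 0 \<and> forces (n m) (Q (K m)) (P m) \<and> (\<exists>i. Inv (K m) (map p [0..<i]))"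
      for m
    have round: "forces (n m - 1) (Q (K m)) (P (Suc m))" if "J m" for m
    proof -
      obtain k where k: "n m = Suc k" using \<open>J m\<close> by (auto simp: J_def gr0_conv_Suc)
      then have "\<exists>e. good (P m) e"
        using \<open>J m\<close> unfolding J_def good_def K_def[symmetric] n_def[symmetric] by auto
      moreover have "p (2 * m) = s (P m)" using p(2) by (simp add: Maker_follows_def P_def)
      ultimately have "good (P m) (p (2 * m))" using s_good by metis
      moreover have "p (Suc (2 * m)) \<in> edges_B - insert (p (2 * m)) (set (P m))"
        using p(1) by (auto simp: play_def P_def inj_eq)
      ultimately show ?thesis unfolding good_def K_def[symmetric] n_def[symmetric] P_Suc by blast
    qed
    have fresh: "J m" if "Inv (K m) (P m)" "n m = N (K m) (P m)" for m
      using N[OF that(1) pos] that unfolding J_def P_def by auto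
    have J_Suc: "J (Suc m) \<and> (if n m = 1 then G (K m) (K (Suc m)) else K (Suc m) = K m \<and> n (Suc m) = n m - 1)"
      if "J m" for m
    proof (cases "n m = 1")
      case True
      then have "Q (K m) (P (Suc m))" using round[OF that] by simp
      from nxt[OF this] have "Inv (K (Suc m)) (P (Suc m)) \<and> G (K m) (K (Suc m))"
        and "n (Suc m) = N (K (Suc m)) (P (Suc m))"
        using True st_Suc[of m] by (simp_all add: K_def[of "Suc m"] n_def[of "Suc m"])
      then show ?thesis using fresh True by simp
    next
      case False
      then have "K (Suc m) = K m" "n (Suc m) = n m - 1"
        using st_Suc[of m] by (simp_all add: K_def[of "Suc m"] n_def[of "Suc m"])
      then show ?thesis using False that round[OF that] by (auto simp: J_def)
    qed
    have "J 0"
      by (rule fresh) (simp_all add: K_def n_def P_def st_def \<open>Inv K0 []\<close>)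
    then have J: "J m" for m by (induction m) (use J_Suc in auto)
    \<comment> \<open>The countdown decreases while the state stays the same, so each state is
      eventually replaced by a successor. Iterating \<open>g\<close> picks out the times of these
      changes.\<close>
    have "\<exists>m'. G (K m) (K m')" for m
    proof (induction "n m" arbitrary: m rule: less_induct)
      case less
      show ?case
      proof (cases "n m = 1")
        case True
        then show ?thesis using J_Suc[OF J, of m] by auto
      next
        case False
        moreover have "n m > 0" using J[of m] by (simp add: J_def)
        ultimately have "n (Suc m) < n m" "K (Suc m) = K m" using J_Suc[OF J, of m] by auto
        then show ?thesis using less[of "Suc m"] by simp
      qed
    qed
    then obtain g where g: "\<And>m. G (K m) (K (g m))" by metis
    have "\<forall>j. G (K ((g ^^ j) 0)) (K ((g ^^ Suc j) 0)) \<and> (\<exists>i. Inv (K ((g ^^ j) 0)) (map p [0..<i]))"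
      using g J by (simp add: J_def)
    then show ?thesis by (rule exI[of _ "\<lambda>j. K ((g ^^ j) 0)"])
  qed
  with strat that show ?thesis by blast
qed

section \<open>Pairing strategies of Breaker\<close>

text \<open>Breaker replies to Maker's last edge with its partner if that is still free. If Maker
  owned both edges of a pair, the second one would have been free after she took the first, and
  Breaker would have claimed it at once. An edge may be its own partner, hence
  \<open>e \<noteq> e'\<close>.\<close>

theorem pairing_strategy:
  fixes R :: "edge \<Rightarrow> edge \<Rightarrow> bool"
  assumes sym: "\<And>e e'. R e e' \<Longrightarrow> R e' e"
    and functional: "\<And>e e' e''. R e e' \<Longrightarrow> R e e'' \<Longrightarrow> e' = e''"
  obtains s where "Breaker_strategy s"
    and "\<And>p e e'. play p \<Longrightarrow> Breaker_follows s p \<Longrightarrow> R e e' \<Longrightarrow> e \<noteq> e' \<Longrightarrow>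
           \<not> {e, e'} \<subseteq> claimed_by_Maker p"
proof -
  define s where "s h = (SOME e. e \<in> edges_B - set h \<and>
      ((\<exists>e' \<in> edges_B - set h. R (last h) e') \<longrightarrow> R (last h) e))" for h
  have s: "s h \<in> edges_B - set h \<and> ((\<exists>e' \<in> edges_B - set h. R (last h) e') \<longrightarrow> R (last h) (s h))" for h
    unfolding s_def
  proof (rule someI_ex)
    show "\<exists>e. e \<in> edges_B - set h \<and> ((\<exists>e' \<in> edges_B - set h. R (last h) e') \<longrightarrow> R (last h) e)"
    proof (cases "\<exists>e' \<in> edges_B - set h. R (last h) e'")
      case True
      then show ?thesis by blast
    next
      case False
      then show ?thesis using unclaimed_exists[of h] by meson
    qed
  qed
  then have strat: "Breaker_strategy s"
    unfolding Breaker_strategy_def by blast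
  have key: False
    if p: "play p" "Breaker_follows s p" and ij: "even i" "even j" "i < j" "R (p i) (p j)" for p i j
  proof -
    have "p (Suc i) = s (map p [0..<Suc i])" using p(2) ij by (simp add: Breaker_follows_def)
    moreover have "p j \<in> edges_B - set (map p [0..<Suc i])"
      using p(1) ij(3) by (auto simp: play_def inj_eq)
    ultimately have "R (p i) (p (Suc i))" using s[of "map p [0..<Suc i]"] ij(4) by auto
    then have "p (Suc i) = p j" using ij(4) functional by blast
    then have "Suc i = j" using p(1) by (auto simp: play_def dest: injD)
    with ij show False by auto
  qed
  have "\<not> {e, e'} \<subseteq> claimed_by_Maker p"
    if p: "play p" "Breaker_follows s p" "R e e'" "e \<noteq> e'" for p e e'
  proof
    assume "{e, e'} \<subseteq> claimed_by_Maker p"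
    then obtain i j where ij: "even i" "even j" "e = p i" "e' = p j"
      by (auto simp: claimed_by_Maker_def)
    with p key[of p i j] key[of p j i] sym show False by (metis nat_neq_iff)
  qed
  with strat show ?thesis by (rule that)
qed

section \<open>Trees of joined vertices\<close>

definition kids :: "nat list set \<Rightarrow> nat list \<Rightarrow> nat set" where
  "kids T p = {v. p @ [v] \<in> T}"

definition verts :: "nat list set \<Rightarrow> nat set" where
  "verts T = \<Union> (set ` T)"

text \<open>
  A set of vertex lists represents a tree: a list is a node, namely the branch leading to it, and
  \<open>[]\<close> is a root that is not a vertex of the graph. Every vertex occurs at most once.
\<close>

definition tree :: "nat list set \<Rightarrow> bool" where
  "tree T \<longleftrightarrow> finite T \<and> [] \<in> T \<and> (\<forall>p v. p @ [v] \<in> T \<longrightarrow> p \<in> T)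
     \<and> (\<forall>p q v. p @ [v] \<in> T \<longrightarrow> q @ [v] \<in> T \<longrightarrow> p = q) \<and> (\<forall>p. card (kids T p) \<le> 4)"

definition full :: "nat list set \<Rightarrow> nat list set" where
  "full T = {p \<in> T. card (kids T p) = 4}"

definition touched :: "edge list \<Rightarrow> nat set" where
  "touched h = \<Union> (set h)"

lemma kids_subset_verts: "kids T p \<subseteq> verts T"
  unfolding kids_def verts_def by force

lemma kids_disjoint: "tree T \<Longrightarrow> p \<noteq> q \<Longrightarrow> kids T p \<inter> kids T q = {}"
  unfolding tree_def kids_def by blast

lemma finite_kids: "tree T \<Longrightarrow> finite (kids T p)"
  unfolding tree_def kids_def using finite_vimageI[of T "\<lambda>v. p @ [v]"] by (auto simp: vimage_def inj_def)

lemma finite_verts: "tree T \<Longrightarrow> finite (verts T)"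
  unfolding tree_def verts_def by auto

lemma finite_full: "tree T \<Longrightarrow> finite (full T)"
  unfolding tree_def full_def by auto

lemma tree_singleton: "tree {[]}"
  unfolding tree_def kids_def by auto

lemma kids_add:
  "kids (T \<union> (\<lambda>y. p @ [y]) ` Y) q = (if q = p then kids T p \<union> Y else kids T q)"
  unfolding kids_def by auto

lemma tree_add:
  assumes "tree T" "p \<in> T" "finite Y" "Y \<inter> verts T = {}" "card (kids T p) + card Y \<le> 4"
  shows "tree (T \<union> (\<lambda>y. p @ [y]) ` Y)"
proof -
  have "card (kids T p \<union> Y) \<le> 4" using card_Un_le[of "kids T p" Y] assms(5) by linarith
  moreover have "v \<in> verts T" if "q @ [v] \<in> T" for q v
    using kids_subset_verts that by (auto simp: kids_def)
  ultimately show ?thesis using assms unfolding tree_def kids_add by auto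
qed

lemma card_touched: "position h \<Longrightarrow> finite (touched h) \<and> card (touched h) \<le> 2 * length h"
proof -
  assume h: "position h"
  have e: "finite e \<and> card e = 2" if "e \<in> set h" for e
    using h that unfolding position_def edges_B_def nsets_def by auto
  have "card (\<Union> (set h)) \<le> (\<Sum>e\<in>set h. card e)" by (rule card_Union_le_sum_card)
  also have "\<dots> = 2 * length h" using e h by (simp add: position_def distinct_card)
  finally show ?thesis using e by (simp add: touched_def)
qed

lemma fresh_edge: "y \<notin> touched h \<Longrightarrow> v \<noteq> y \<Longrightarrow> {v, y} \<in> edges_B - set h"
  unfolding touched_def edges_B_def by auto

lemma maker_edges_subset: "maker_edges h \<subseteq> set h"
  unfolding maker_edges_def by auto

section \<open>Joining new vertices to a tree\<close>

text \<open>
  \<open>S\<close> stands for the vertices joined to \<open>x\<close>, so \<open>p\<close> can be extended by \<open>x\<close> and then \<open>y\<close>.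
\<close>

definition lands :: "nat list set \<Rightarrow> nat set \<Rightarrow> nat \<Rightarrow> nat \<Rightarrow> edge list \<Rightarrow> bool" where
  "lands T S x y h \<longleftrightarrow> {x, y} \<in> maker_edges h \<and>
     (\<exists>p \<in> T - full T. set p \<subseteq> S \<and> (\<forall>v \<in> set p. {v, y} \<in> maker_edges h))"

lemma lands_append: "lands T S x y h \<Longrightarrow> lands T S x y (h @ t)"
  unfolding lands_def using maker_edges_append[of h t] by blast

text \<open>Two kids in \<open>S\<close> of a full node give a pair of edges to \<open>y\<close>, of
  which Maker obtains one. Following the obtained kids from the root leads through full nodes only
  as long as possible, so it ends at a node that is not full.\<close>

lemma forces_lands:
  assumes T: "tree T" and h: "position h" "even (length h)"
    and y: "y \<notin> touched h" "y \<notin> verts T" "x \<noteq> y" and x: "x \<notin> verts T"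
    and S: "\<forall>p\<in>full T. \<exists>a b. a \<noteq> b \<and> {a, b} \<subseteq> kids T p \<inter> S"
  shows "forces (Suc (card (full T))) (lands T S x y) h"
proof -
  from S obtain a b where ab: "\<And>p. p \<in> full T \<Longrightarrow> a p \<noteq> b p \<and> {a p, b p} \<subseteq> kids T p \<inter> S"
    by metis
  \<comment> \<open>\<open>None\<close> stands for the single edge \<open>{x, y}\<close>, which
    Maker has to take first and which is therefore the exceptional index in
    \<open>forces_hit\<close>.\<close>
  define V where "V i = (case i of None \<Rightarrow> {x} | Some p \<Rightarrow> {a p, b p})" for i
  define I where "I = insert None (Some ` full T)"
  have card_I: "card I = Suc (card (full T))"
    unfolding I_def using finite_full[OF T] by (simp add: card_image)
  have V_verts: "V (Some p) \<subseteq> verts T" if "p \<in> full T" for p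
    using ab[OF that] kids_subset_verts[of T p] by (auto simp: V_def)
  have Vy: "v \<noteq> y" if "i \<in> I" "v \<in> V i" for i v
    using that y x V_verts by (auto simp: I_def V_def)
  have dbl: "{v, y} = {w, y} \<Longrightarrow> v = w" for v w by (auto simp: doubleton_eq_iff)
  have V_disj: "V i \<inter> V j = {}" if ij: "i \<in> I" "j \<in> I" "i \<noteq> j" for i j
  proof (cases i; cases j)
    fix p q assume "i = Some p" "j = Some q"
    then show ?thesis using ij ab[of p] ab[of q] kids_disjoint[OF T, of p q] by (auto simp: I_def V_def)
  qed (use ij V_verts x in \<open>auto simp: I_def V_def\<close>)
  have "forces (card I) (\<lambda>h'. \<forall>i\<in>I. (\<lambda>v. {v, y}) ` V i \<inter> maker_edges h' \<noteq> {}) h"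
  proof (rule forces_hit[where ?i0.0 = None])
    show "finite I" using finite_full[OF T] by (simp add: I_def)
    show "\<forall>i\<in>I. (\<lambda>v. {v, y}) ` V i \<subseteq> edges_B - set h \<and> (\<lambda>v. {v, y}) ` V i \<noteq> {}"
    proof
      fix i assume "i \<in> I"
      then show "(\<lambda>v. {v, y}) ` V i \<subseteq> edges_B - set h \<and> (\<lambda>v. {v, y}) ` V i \<noteq> {}"
        using fresh_edge[OF y(1)] Vy by (auto simp: V_def split: option.splits)
    qed
    show "\<forall>i\<in>I. \<forall>j\<in>I. i \<noteq> j \<longrightarrow> (\<lambda>v. {v, y}) ` V i \<inter> (\<lambda>v. {v, y}) ` V j = {}"
      using V_disj dbl by blast
    show "\<forall>i\<in>I. i \<noteq> None \<longrightarrow> (\<forall>e. \<not> (\<lambda>v. {v, y}) ` V i \<subseteq> {e})"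
    proof (intro ballI impI allI notI)
      fix i e assume "i \<in> I" "i \<noteq> None" and sub: "(\<lambda>v. {v, y}) ` V i \<subseteq> {e}"
      then obtain p where p: "p \<in> full T" "i = Some p" by (auto simp: I_def)
      with sub have "{a p, y} = {b p, y}" by (simp add: V_def)
      then show False using dbl ab[OF p(1)] by blast
    qed
  qed (use h in auto)
  then show ?thesis unfolding card_I
  proof (rule forces_mono[OF _ h(1)])
    fix t assume hit: "\<forall>i\<in>I. (\<lambda>v. {v, y}) ` V i \<inter> maker_edges (h @ t) \<noteq> {}"
    let ?J = "{v. {v, y} \<in> maker_edges (h @ t)}"
    \<comment> \<open>A longest node in \<open>A\<close> cannot be full, since one of its two chosen
      kids would extend it within \<open>A\<close>.\<close>
    define A where "A = {p \<in> T. set p \<subseteq> S \<inter> ?J}"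
    have A: "finite (length ` A)" "length ` A \<noteq> {}" using T by (auto simp: A_def tree_def intro!: exI[of _ "[]"])
    from Max_in[OF A] obtain p where p: "p \<in> A" "length p = Max (length ` A)" by auto
    have max: "length q \<le> length p" if "q \<in> A" for q using Max_ge[OF A(1), of "length q"] that p by simp
    have "p \<notin> full T"
    proof
      assume f: "p \<in> full T"
      with hit obtain v where "v \<in> V (Some p)" "v \<in> ?J" unfolding I_def by blast
      with ab[OF f] p have "p @ [v] \<in> A" by (auto simp: V_def A_def kids_def)
      then show False using max by fastforce
    qed
    with p hit show "lands T S x y (h @ t)" by (auto simp: lands_def A_def I_def V_def)
  qed
qed

text \<open>The vertices are treated one after another, each one untouched when its turn comes.
  \<open>Y\<close> is large enough for this because every claimed edge touches only two
  vertices.\<close>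

lemma forces_many_land:
  assumes T: "tree T" and h: "position h" "even (length h)"
    and Y: "finite Y" "Y \<inter> verts T = {}" "x \<notin> Y" and x: "x \<notin> verts T"
    and S: "\<forall>p\<in>full T. \<exists>a b. a \<noteq> b \<and> {a, b} \<subseteq> kids T p \<inter> S"
    and big: "card Y > 2 * (length h + 2 * (k * Suc (card (full T))))"
  shows "forces (k * Suc (card (full T))) (\<lambda>h'. \<exists>Z\<subseteq>Y. card Z = k \<and> (\<forall>y\<in>Z. lands T S x y h')) h"
  using big
proof (induction k)
  case 0
  then show ?case by (auto intro!: exI[of _ "{}"])
next
  case (Suc k)
  let ?m = "Suc (card (full T))"
  have "forces (k * ?m + ?m) (\<lambda>h'. \<exists>Z\<subseteq>Y. card Z = Suc k \<and> (\<forall>y\<in>Z. lands T S x y h')) h"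
  proof (rule forces_seq[OF _ h(1)])
    show "forces (k * ?m) (\<lambda>h'. \<exists>Z\<subseteq>Y. card Z = k \<and> (\<forall>y\<in>Z. lands T S x y h')) h"
      using Suc by simp
    fix t assume pos: "position (h @ t)" and t: "length t = 2 * (k * ?m)"
      and "\<exists>Z\<subseteq>Y. card Z = k \<and> (\<forall>y\<in>Z. lands T S x y (h @ t))"
    then obtain Z where Z: "Z \<subseteq> Y" "card Z = k" "\<forall>y\<in>Z. lands T S x y (h @ t)" by blast
    have "card (touched (h @ t)) < card Y" using card_touched[OF pos] t Suc.prems by simp
    then obtain y where y: "y \<in> Y" "y \<notin> touched (h @ t)"
      using card_touched[OF pos] card_mono[of "touched (h @ t)" Y] by fastforce
    \<comment> \<open>Vertices that have landed are touched, through their edge to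
      \<open>x\<close>.\<close>
    have "y \<notin> Z"
      using Z(3) y(2) maker_edges_subset[of "h @ t"] by (auto simp: lands_def touched_def)
    with Z finite_subset[OF Z(1) Y(1)] have Z': "card (insert y Z) = Suc k" by simp
    have "forces ?m (lands T S x y) (h @ t)"
      by (rule forces_lands[OF T pos]) (use h t y Y x S in auto)
    then show "forces ?m (\<lambda>h'. \<exists>Z\<subseteq>Y. card Z = Suc k \<and> (\<forall>y\<in>Z. lands T S x y h')) (h @ t)"
    proof (rule forces_mono[OF _ pos])
      fix r assume "lands T S x y ((h @ t) @ r)"
      then have "\<forall>z\<in>insert y Z. lands T S x z ((h @ t) @ r)" using Z(3) lands_append by blast
      with Z(1) Z' y(1) show "\<exists>Z\<subseteq>Y. card Z = Suc k \<and> (\<forall>y\<in>Z. lands T S x y ((h @ t) @ r))"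
        by (intro exI[of _ "insert y Z"]) auto
    qed
  qed
  moreover have "k * ?m + ?m = Suc k * ?m" by simp
  ultimately show ?case by metis
qed

text \<open>The four kids of a full node are split into two pairs and Maker takes an edge from
  \<open>x\<close> to each pair. Kids of different nodes are different, so all these pairs are
  disjoint.\<close>

lemma forces_two_kids:
  assumes T: "tree T" and h: "position h" "even (length h)"
    and x: "x \<notin> touched h" "x \<notin> verts T"
  shows "forces (card (full T) * 2)
    (\<lambda>h'. \<forall>p\<in>full T. \<exists>a b. a \<noteq> b \<and> {a, b} \<subseteq> kids T p \<inter> {v. {v, x} \<in> maker_edges h'}) h"
proof -
  have "\<exists>P. \<forall>b. P b \<subseteq> kids T p \<and> card (P b) = 2 \<and> P b \<inter> P (\<not> b) = {}" if "p \<in> full T" for p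
  proof -
    have c: "card (kids T p) = 4" using that by (simp add: full_def)
    then obtain A where A: "A \<subseteq> kids T p" "card A = 2"
      using obtain_subset_with_card_n[of 2 "kids T p"] by auto
    then have "card (kids T p - A) = 2" using c finite_kids[OF T] by (simp add: card_Diff_subset finite_subset)
    with A show ?thesis by (intro exI[of _ "\<lambda>b. if b then A else kids T p - A"]) auto
  qed
  then obtain P where P: "\<And>p b. p \<in> full T \<Longrightarrow> P p b \<subseteq> kids T p \<and> card (P p b) = 2 \<and> P p b \<inter> P p (\<not> b) = {}"
    by metis
  define I where "I = full T \<times> (UNIV :: bool set)"
  define A where "A i = (\<lambda>v. {v, x}) ` P (fst i) (snd i)" for i
  have card_I: "card I = card (full T) * 2" by (simp add: I_def card_cartesian_product)
  have dbl: "{v, x} = {w, x} \<Longrightarrow> v = w" for v w by (auto simp: doubleton_eq_iff)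
  have "forces (card I) (\<lambda>h'. \<forall>i\<in>I. A i \<inter> maker_edges h' \<noteq> {}) h"
  proof (rule forces_hit)
    show "finite I" using finite_full[OF T] by (simp add: I_def)
    show "\<forall>i\<in>I. A i \<subseteq> edges_B - set h \<and> A i \<noteq> {}"
    proof
      fix i assume "i \<in> I"
      then have i: "P (fst i) (snd i) \<subseteq> verts T" "card (P (fst i) (snd i)) = 2"
        using P[of "fst i" "snd i"] kids_subset_verts[of T "fst i"] by (force simp: I_def)+
      then have "v \<noteq> x" if "v \<in> P (fst i) (snd i)" for v using that x by auto
      then show "A i \<subseteq> edges_B - set h \<and> A i \<noteq> {}"
        using fresh_edge[OF x(1)] i(2) by (auto simp: A_def)
    qed
    show "\<forall>i\<in>I. \<forall>j\<in>I. i \<noteq> j \<longrightarrow> A i \<inter> A j = {}"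
    proof (intro ballI impI)
      fix i j assume ij: "i \<in> I" "j \<in> I" "i \<noteq> j"
      have "P (fst i) (snd i) \<inter> P (fst j) (snd j) = {}"
      proof (cases "fst i = fst j")
        case True
        then have "snd j = (\<not> snd i)" using ij(3) by (auto simp: prod_eq_iff)
        with True P[of "fst i" "snd i"] ij show ?thesis by (auto simp: I_def)
      next
        case False
        with kids_disjoint[OF T False] P[of "fst i" "snd i"] P[of "fst j" "snd j"] ij
        show ?thesis by (fastforce simp: I_def)
      qed
      then show "A i \<inter> A j = {}" unfolding A_def using dbl by blast
    qed
    \<comment> \<open>Every set has two edges, so there is no exceptional index and
      \<open>i0\<close> is arbitrary.\<close>
    show "\<forall>i\<in>I. i \<noteq> i0 \<longrightarrow> (\<forall>e. \<not> A i \<subseteq> {e})" for i0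
    proof (intro ballI impI allI notI)
      fix i e assume "i \<in> I" "A i \<subseteq> {e}"
      then obtain a b where "P (fst i) (snd i) = {a, b}" "a \<noteq> b"
        using P[of "fst i" "snd i"] by (auto simp: I_def card_2_iff)
      with \<open>A i \<subseteq> {e}\<close> show False using dbl[of a b] by (auto simp: A_def)
    qed
  qed (use h in auto)
  then show ?thesis unfolding card_I
  proof (rule forces_mono[OF _ h(1)])
    fix t assume hit: "\<forall>i\<in>I. A i \<inter> maker_edges (h @ t) \<noteq> {}"
    show "\<forall>p\<in>full T. \<exists>a b. a \<noteq> b \<and> {a, b} \<subseteq> kids T p \<inter> {v. {v, x} \<in> maker_edges (h @ t)}"
    proof
      fix p assume p: "p \<in> full T"
      have "\<exists>a\<in>P p b. {a, x} \<in> maker_edges (h @ t)" for b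
        using hit[rule_format, of "(p, b)"] p by (auto simp: I_def A_def)
      then obtain a b where "a \<in> P p True" "b \<in> P p False"
        "{a, x} \<in> maker_edges (h @ t)" "{b, x} \<in> maker_edges (h @ t)" by metis
      moreover have "a \<noteq> b" using calculation P[OF p, of True] by auto
      ultimately show "\<exists>a b. a \<noteq> b \<and> {a, b} \<subseteq> kids T p \<inter> {v. {v, x} \<in> maker_edges (h @ t)}"
        using P[OF p, of True] P[OF p, of False] by (intro exI[of _ a] exI[of _ b]) auto
    qed
  qed
qed

section \<open>Infinite branches\<close>

text \<open>A node with infinitely many extensions in \<open>T\<close> has a child with infinitely
  many extensions, by finite branching. Iterating this from the root gives the branch.\<close>

lemma konig:
  assumes inf: "infinite T" and pre: "\<And>p v. p @ [v] \<in> T \<Longrightarrow> p \<in> T"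
    and fin: "\<And>p. finite {v. p @ [v] \<in> T}"
  shows "\<exists>f :: nat \<Rightarrow> 'a. \<forall>n. map f [0..<n] \<in> T"
proof -
  define big where "big p \<longleftrightarrow> infinite {q \<in> T. \<exists>r. q = p @ r}" for p
  have prefix: "p \<in> T" if "p @ r \<in> T" for p r
    using that by (induction r rule: rev_induct) (auto intro: pre simp flip: append_assoc)
  have step: "\<exists>v. big (p @ [v])" if "big p" for p
  proof (rule ccontr)
    assume "\<not> ?thesis"
    then have "finite (insert p (\<Union>v\<in>{v. p @ [v] \<in> T}. {q \<in> T. \<exists>r. q = (p @ [v]) @ r}))"
      using fin unfolding big_def by blast
    moreover have "{q \<in> T. \<exists>r. q = p @ r} \<subseteq>
        insert p (\<Union>v\<in>{v. p @ [v] \<in> T}. {q \<in> T. \<exists>r. q = (p @ [v]) @ r})"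
    proof
      fix q assume "q \<in> {q \<in> T. \<exists>r. q = p @ r}"
      then obtain r where r: "q \<in> T" "q = p @ r" by blast
      show "q \<in> insert p (\<Union>v\<in>{v. p @ [v] \<in> T}. {q \<in> T. \<exists>r. q = (p @ [v]) @ r})"
      proof (cases r)
        case (Cons v r')
        then have "p @ [v] \<in> T" using r prefix[of "p @ [v]" r'] by simp
        with r Cons show ?thesis by auto
      qed (use r in simp)
    qed
    ultimately show False using that finite_subset unfolding big_def by blast
  qed
  define g where "g p = (SOME v. big (p @ [v]))" for p
  define P where "P = rec_nat [] (\<lambda>_ p. p @ [g p])"
  have P: "P 0 = []" "\<And>n. P (Suc n) = P n @ [g (P n)]" by (simp_all add: P_def)
  have "big (P n)" for n
  proof (induction n)
    case 0
    then show ?case using inf by (simp add: P big_def)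
  next
    case (Suc n)
    then show ?case unfolding P g_def using someI_ex[OF step] by blast
  qed
  moreover have "p \<in> T" if "big p" for p
  proof -
    have "{q \<in> T. \<exists>r. q = p @ r} \<noteq> {}" using that unfolding big_def by force
    then show ?thesis using prefix by blast
  qed
  moreover have "map (\<lambda>n. g (P n)) [0..<n] = P n" for n
    by (induction n) (simp_all add: P)
  ultimately show ?thesis by metis
qed

text \<open>Strict growth makes the union infinite and the common bound on the number of kids makes
  it finitely branching. The branch is injective because a vertex has only one parent node in each
  tree.\<close>

lemma infinite_branch:
  fixes T :: "nat \<Rightarrow> nat list set"
  assumes T: "\<And>j. tree (T j)" "\<And>j. T j \<subset> T (Suc j)"
  obtains f where "inj f" "\<And>n. \<exists>j. map f [0..<n] \<in> T j"
proof -
  have mono: "T i \<subseteq> T j" if "i \<le> j" for i j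
    by (rule lift_Suc_mono_le[OF _ that]) (use T(2) in blast)
  have "strict_mono (\<lambda>j. card (T j))"
    unfolding strict_mono_Suc_iff using T(1) psubset_card_mono[OF _ T(2)] by (simp add: tree_def)
  have "infinite (\<Union>j. T j)"
  proof
    assume fin: "finite (\<Union>j. T j)"
    have "card (T (Suc (card (\<Union>j. T j)))) \<le> card (\<Union>j. T j)" by (rule card_mono[OF fin]) auto
    with strict_mono_imp_increasing[OF \<open>strict_mono (\<lambda>j. card (T j))\<close>, of "Suc (card (\<Union>j. T j))"]
    show False by simp
  qed
  moreover have "p \<in> (\<Union>j. T j)" if "p @ [v] \<in> (\<Union>j. T j)" for p v
  proof -
    from that obtain j where "p @ [v] \<in> T j" by blast
    then have "p \<in> T j" using T(1)[of j] unfolding tree_def by blast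
    then show ?thesis by blast
  qed
  moreover have "finite {v. p @ [v] \<in> (\<Union>j. T j)}" for p
  proof -
    \<comment> \<open>Only finitely many kids at a time are sure to lie in a common
      \<open>T j\<close>, so the bound is shown for all finite subsets.\<close>
    have "card F \<le> 4" if F: "F \<subseteq> {v. p @ [v] \<in> (\<Union>j. T j)}" "finite F" for F
    proof -
      from F have "\<forall>v\<in>F. \<exists>j. p @ [v] \<in> T j" by auto
      then obtain j where j: "\<forall>v\<in>F. p @ [v] \<in> T (j v)" by metis
      have "T (j v) \<subseteq> T (Max (insert 0 (j ` F)))" if "v \<in> F" for v
        using F(2) that by (intro mono) simp
      then have "F \<subseteq> kids (T (Max (insert 0 (j ` F)))) p"
        using j unfolding kids_def by blast
      then have "card F \<le> card (kids (T (Max (insert 0 (j ` F)))) p)"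
        using card_mono finite_kids[OF T(1)] by blast
      also have "\<dots> \<le> 4" using T(1) by (simp add: tree_def)
      finally show ?thesis .
    qed
    then show ?thesis using finite_if_finite_subsets_card_bdd[of _ 4] by blast
  qed
  ultimately obtain f where "\<forall>n. map f [0..<n] \<in> (\<Union>j. T j)" using konig[of "\<Union>j. T j"] by auto
  then have f: "\<exists>j. map f [0..<n] \<in> T j" for n by blast
  have "f i \<noteq> f j" if "i < j" for i j
  proof
    assume eq: "f i = f j"
    obtain a b where "map f [0..<Suc i] \<in> T a" "map f [0..<Suc j] \<in> T b" using f[of "Suc i"] f[of "Suc j"] by blast
    then have "map f [0..<i] @ [f i] \<in> T (max a b)" "map f [0..<j] @ [f j] \<in> T (max a b)"
      using mono[of a "max a b"] mono[of b "max a b"] by auto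
    then have "map f [0..<i] = map f [0..<j]" using T(1)[of "max a b"] eq unfolding tree_def by metis
    then show False using that by (metis length_map length_upt minus_nat.diff_0 nat_neq_iff)
  qed
  then have "inj f" by (metis injI nat_neq_iff)
  with f that show ?thesis by blast
qed

section \<open>Enlarging the tree\<close>

lemma nsets_insert_2: "nsets (insert x A) 2 \<subseteq> nsets A 2 \<union> (\<lambda>v. {v, x}) ` A"
  by (auto simp: nsets_2_eq insert_commute)

text \<open>Finite stars of any size exist off every finite set. \<open>E\<close> is an arbitrary
  relation since it serves both for adjacency in a colour and for pairs taken from two homogeneous
  sets.\<close>

definition star_rich :: "(nat \<Rightarrow> nat \<Rightarrow> bool) \<Rightarrow> bool" where
  "star_rich E \<longleftrightarrow> (\<forall>F q. finite F \<longrightarrow> (\<exists>x Y. x \<notin> F \<and> finite Y \<and> q \<le> card Y \<and> x \<notin> Y \<and> Y \<inter> F = {}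
     \<and> (\<forall>y\<in>Y. E x y)))"

text \<open>
  Nodes of odd length end in the centre of a star and receive all their four children at once, so
  that only nodes of even length ever have to be extended.
\<close>

definition star_tree :: "(nat \<Rightarrow> nat \<Rightarrow> bool) \<Rightarrow> nat list set \<Rightarrow> edge list \<Rightarrow> bool" where
  "star_tree E T h \<longleftrightarrow> tree T \<and> (\<forall>p\<in>T. nsets (set p) 2 \<subseteq> maker_edges h
      \<and> (\<forall>k. Suc (2 * k) < length p \<longrightarrow> E (p ! (2 * k)) (p ! Suc (2 * k)))
      \<and> (odd (length p) \<longrightarrow> p \<in> full T))"

text \<open>With \<open>u\<close> outside \<open>W\<close>, the fixed centre \<open>u\<close> stays
  outside the tree and is joined to all of its vertices.\<close>

definition rooted_tree :: "nat \<Rightarrow> nat set \<Rightarrow> nat list set \<Rightarrow> edge list \<Rightarrow> bool" where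
  "rooted_tree u W T h \<longleftrightarrow> tree T \<and> verts T \<subseteq> W \<and>
     (\<forall>p\<in>T. nsets (insert u (set p)) 2 \<subseteq> maker_edges h)"

lemma rooted_tree_step:
  assumes W: "infinite W" "u \<notin> W" and T: "rooted_tree u W T h" and h: "position h" "even (length h)"
  shows "\<exists>n>0. forces n (\<lambda>h'. \<exists>T'. T \<subset> T' \<and> rooted_tree u W T' h') h"
proof -
  have tree: "tree T" using T by (simp add: rooted_tree_def)
  have u: "u \<notin> verts T" using T W by (auto simp: rooted_tree_def)
  have "finite (touched h \<union> verts T)" using card_touched[OF h(1)] finite_verts[OF tree] by simp
  then obtain y where y: "y \<in> W" "y \<notin> touched h" "y \<notin> verts T"
    using W(1) by (metis UnCI finite_subset subsetI)
  have "u \<noteq> y" using y W by auto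
  \<comment> \<open>As \<open>u\<close> is already joined to the whole tree, \<open>UNIV\<close> can
    stand for the vertices joined to the centre.\<close>
  have S: "\<forall>p\<in>full T. \<exists>a b. a \<noteq> b \<and> {a, b} \<subseteq> kids T p \<inter> UNIV"
  proof
    fix p assume "p \<in> full T"
    then have "2 \<le> card (kids T p)" by (simp add: full_def)
    then obtain A where "A \<subseteq> kids T p" "card A = 2" using obtain_subset_with_card_n by metis
    then show "\<exists>a b. a \<noteq> b \<and> {a, b} \<subseteq> kids T p \<inter> UNIV" by (auto simp: card_2_iff)
  qed
  have "forces (Suc (card (full T))) (\<lambda>h'. \<exists>T'. T \<subset> T' \<and> rooted_tree u W T' h') h"
  proof (rule forces_mono[OF forces_lands[OF tree h y(2,3) \<open>u \<noteq> y\<close> u S] h(1)])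
    fix t assume "lands T UNIV u y (h @ t)"
    then obtain p where p: "{u, y} \<in> maker_edges (h @ t)" "p \<in> T" "p \<notin> full T"
      "\<forall>v\<in>set p. {v, y} \<in> maker_edges (h @ t)" by (auto simp: lands_def)
    have "card (kids T p) \<le> 4" "card (kids T p) \<noteq> 4" using p tree by (auto simp: full_def tree_def)
    then have T': "tree (T \<union> (\<lambda>y. p @ [y]) ` {y})"
      using y by (intro tree_add[OF tree p(2)]) auto
    have verts: "verts (T \<union> (\<lambda>y. p @ [y]) ` {y}) \<subseteq> W"
      using T p(2) y(1) by (auto simp: rooted_tree_def verts_def)
    have "nsets (insert u (set q)) 2 \<subseteq> maker_edges (h @ t)" if "q \<in> T" for q
      using T that maker_edges_append[of h t] by (auto simp: rooted_tree_def)
    moreover have "nsets (insert y (insert u (set p))) 2 \<subseteq> maker_edges (h @ t)"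
      using nsets_insert_2[of y "insert u (set p)"] calculation[OF p(2)] p(1,4) by auto
    ultimately have "rooted_tree u W (T \<union> (\<lambda>y. p @ [y]) ` {y}) (h @ t)"
      using T' verts by (auto simp: rooted_tree_def insert_commute)
    moreover have "p @ [y] \<notin> T" using y(3) by (auto simp: verts_def)
    ultimately show "\<exists>T'. T \<subset> T' \<and> rooted_tree u W T' (h @ t)"
      by (intro exI[of _ "T \<union> (\<lambda>y. p @ [y]) ` {y}"]) auto
  qed
  then show ?thesis by blast
qed

lemma star_tree_step:
  assumes stars: "star_rich E"
    and T: "star_tree E T h" and h: "position h" "even (length h)"
  shows "\<exists>n>0. forces n (\<lambda>h'. \<exists>T'. T \<subset> T' \<and> star_tree E T' h') h"
proof -
  have tree: "tree T" using T by (simp add: star_tree_def)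
  define m where "m = card (full T)"
  \<comment> \<open>With \<open>4 * card T\<close> landings, more than three per node on average,
    four vertices must land at the same node.\<close>
  define N where "N = 4 * card T"
  have cT: "card T > 0" using tree by (auto simp: tree_def card_gt_0_iff)
  have "finite (touched h \<union> verts T)" using card_touched[OF h(1)] finite_verts[OF tree] by simp
  \<comment> \<open>Joining \<open>x\<close> takes \<open>m * 2\<close> rounds and the landings take
    \<open>N * Suc m\<close>. Two edges per round and two vertices per edge give the required size
    of the star.\<close>
  from stars[unfolded star_rich_def, rule_format, OF this, of "Suc (2 * (length h + 2 * (m * 2) + 2 * (N * Suc m)))"]
  obtain x Y where x: "x \<notin> touched h" "x \<notin> verts T" and Y: "finite Y" "x \<notin> Y" "Y \<inter> verts T = {}"
    and cY: "card Y > 2 * (length h + 2 * (m * 2) + 2 * (N * Suc m))" and E: "\<forall>y\<in>Y. E x y"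
    by (auto simp: Suc_le_eq)
  have "forces (m * 2 + N * Suc m) (\<lambda>h'. \<exists>T'. T \<subset> T' \<and> star_tree E T' h') h"
  proof (rule forces_seq[OF forces_two_kids[OF tree h x, folded m_def] h(1)])
    fix t
    define S where "S = {v. {v, x} \<in> maker_edges (h @ t)}"
    assume pos: "position (h @ t)" and t: "length t = 2 * (m * 2)"
      and "\<forall>p\<in>full T. \<exists>a b. a \<noteq> b \<and> {a, b} \<subseteq> kids T p \<inter> {v. {v, x} \<in> maker_edges (h @ t)}"
    then have S: "\<forall>p\<in>full T. \<exists>a b. a \<noteq> b \<and> {a, b} \<subseteq> kids T p \<inter> S" by (simp add: S_def)
    have "forces (N * Suc m) (\<lambda>h'. \<exists>Z\<subseteq>Y. card Z = N \<and> (\<forall>y\<in>Z. lands T S x y h')) (h @ t)"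
      using forces_many_land[OF tree pos _ Y(1,3,2) x(2) S, of N] h t cY by (simp add: m_def)
    then show "forces (N * Suc m) (\<lambda>h'. \<exists>T'. T \<subset> T' \<and> star_tree E T' h') (h @ t)"
    proof (rule forces_mono[OF _ pos])
      fix r
      let ?h = "(h @ t) @ r"
      assume "\<exists>Z\<subseteq>Y. card Z = N \<and> (\<forall>y\<in>Z. lands T S x y ?h)"
      then obtain Z where Z: "Z \<subseteq> Y" "card Z = N" "\<forall>y\<in>Z. lands T S x y ?h" by blast
      then have "\<forall>y\<in>Z. \<exists>p. p \<in> T - full T \<and> set p \<subseteq> S \<and> (\<forall>v\<in>set p. {v, y} \<in> maker_edges ?h)"
        unfolding lands_def by blast
      then obtain g where g: "\<forall>y\<in>Z. g y \<in> T - full T \<and> set (g y) \<subseteq> S \<and>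
          (\<forall>v\<in>set (g y). {v, y} \<in> maker_edges ?h)"
        by metis
      have "finite Z" using Z(1) Y(1) finite_subset by blast
      have "\<exists>p\<in>T. 4 \<le> card {y \<in> Z. g y = p}"
      proof (rule ccontr)
        assume "\<not> ?thesis"
        then have "card {y \<in> Z. g y = p} \<le> 3" if "p \<in> T" for p using that by force
        then have "(\<Sum>p\<in>T. card {y \<in> Z. g y = p}) \<le> card T * 3"
          using sum_bounded_above[of T "\<lambda>p. card {y \<in> Z. g y = p}" 3] by simp
        moreover have "(\<Union>p\<in>T. {y \<in> Z. g y = p}) = Z" using g by auto
        moreover have "card (\<Union>p\<in>T. {y \<in> Z. g y = p}) \<le> (\<Sum>p\<in>T. card {y \<in> Z. g y = p})"
          using tree by (intro card_UN_le) (simp add: tree_def)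
        ultimately show False using Z(2) cT by (simp add: N_def)
      qed
      then obtain p where p: "p \<in> T" "4 \<le> card {y \<in> Z. g y = p}" by blast
      from obtain_subset_with_card_n[OF p(2)]
      obtain D where D: "D \<subseteq> {y \<in> Z. g y = p}" "card D = 4" "finite D" by metis
      note p = p(1)
      have DY: "D \<subseteq> Y" using D(1) Z(1) by blast
      from D(2) obtain d where "d \<in> D" by fastforce
      then have d: "d \<in> Z" "g d = p" using D by auto
      with g have pS: "p \<notin> full T" "set p \<subseteq> S" by auto
      have pD: "{v, y} \<in> maker_edges ?h" if "y \<in> D" "v \<in> set p" for v y
        using g D that by blast
      have xD: "{x, y} \<in> maker_edges ?h" if "y \<in> D" for y
        using Z(3) D that by (auto simp: lands_def)
      \<comment> \<open>Nodes of odd length are full but \<open>p\<close> is not. So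
        \<open>x\<close> gets an even index and its four kids an odd one, as the pairs related by
        \<open>E\<close> require.\<close>
      have even_p: "even (length p)" using T p pS by (auto simp: star_tree_def)
      then obtain j where j: "length p = 2 * j" by blast
      have verts_x: "verts (T \<union> (\<lambda>y. p @ [y]) ` {x}) \<subseteq> insert x (verts T)" using p by (auto simp: verts_def)
      have no_kids: "kids T (p @ [x]) = {}"
        using x(2) tree by (auto simp: kids_def verts_def)
      define T1 where "T1 = T \<union> (\<lambda>y. p @ [y]) ` {x}"
      define T2 where "T2 = T1 \<union> (\<lambda>y. (p @ [x]) @ [y]) ` D"
      have "card (kids T p) \<le> 4" "card (kids T p) \<noteq> 4" using p pS tree by (auto simp: full_def tree_def)
      then have T1: "tree T1"
        unfolding T1_def using x by (intro tree_add[OF tree p]) auto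
      have kids1: "kids T1 (p @ [x]) = {}" unfolding T1_def kids_add using no_kids by simp
      have T2: "tree T2"
        unfolding T2_def
      proof (rule tree_add[OF T1])
        show "D \<inter> verts T1 = {}" using verts_x DY Y unfolding T1_def by blast
      qed (simp_all add: D kids1, simp add: T1_def)
      have kids2: "kids T2 q = (if q = p @ [x] then D else if q = p then insert x (kids T p) else kids T q)" for q
        unfolding T2_def kids_add kids1 unfolding T1_def kids_add by auto
      have old: "nsets (set q) 2 \<subseteq> maker_edges ?h" if "q \<in> T" for q
        using T that maker_edges_append[of h "t @ r"] by (auto simp: star_tree_def)
      have "\<forall>v\<in>set p. {v, x} \<in> maker_edges ?h"
        using pS maker_edges_append[of "h @ t" r] by (auto simp: S_def)
      then have px: "nsets (set (p @ [x])) 2 \<subseteq> maker_edges ?h"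
        using nsets_insert_2[of x "set p"] old[OF p] by auto
      have pxy: "nsets (set (p @ [x, y])) 2 \<subseteq> maker_edges ?h" if "y \<in> D" for y
      proof -
        have "set (p @ [x, y]) = insert y (set (p @ [x]))" by auto
        then show ?thesis using nsets_insert_2[of y "set (p @ [x])"] px pD[OF that] xD[OF that] by auto
      qed
      have "star_tree E T2 ?h"
        unfolding star_tree_def
      proof (intro conjI ballI)
        fix q assume "q \<in> T2"
        then consider "q \<in> T" | "q = p @ [x]" | y where "y \<in> D" "q = p @ [x, y]"
          by (auto simp: T2_def T1_def)
        then have "nsets (set q) 2 \<subseteq> maker_edges ?h \<and>
           (\<forall>k. Suc (2 * k) < length q \<longrightarrow> E (q ! (2 * k)) (q ! Suc (2 * k))) \<and>
           (odd (length q) \<longrightarrow> q \<in> full T2)"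
        proof cases
          case 1
          then have "q \<in> full T \<and> q \<noteq> p \<and> q \<noteq> p @ [x]" if "odd (length q)"
            using T that pS no_kids by (auto simp: star_tree_def full_def)
          then have "q \<in> full T2" if "odd (length q)"
            using \<open>q \<in> T2\<close> that by (simp add: full_def kids2)
          with 1 show ?thesis using T old by (simp add: star_tree_def)
        next
          case 2
          have "E (q ! (2 * k)) (q ! Suc (2 * k))" if "Suc (2 * k) < length q" for k
          proof -
            have "Suc (2 * k) < length p" using that 2 j by simp
            then show ?thesis using 2 T p by (simp add: star_tree_def nth_append)
          qed
          moreover have "q \<in> full T2" using 2 \<open>q \<in> T2\<close> D(2) by (simp add: full_def kids2)
          ultimately show ?thesis using px 2 by blast
        next
          case 3
          have "E (q ! (2 * k)) (q ! Suc (2 * k))" if "Suc (2 * k) < length q" for k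
          proof (cases "Suc (2 * k) < length p")
            case True
            then show ?thesis using 3 T p by (simp add: star_tree_def nth_append)
          next
            case False
            with that 3 j have "length p = 2 * k" by simp
            then show ?thesis using 3 E DY by (auto simp: nth_append)
          qed
          moreover have "even (length q)" using 3 even_p by simp
          ultimately show ?thesis using pxy 3 by blast
        qed
        then show "nsets (set q) 2 \<subseteq> maker_edges ?h"
          and "\<forall>k. Suc (2 * k) < length q \<longrightarrow> E (q ! (2 * k)) (q ! Suc (2 * k))"
          and "odd (length q) \<longrightarrow> q \<in> full T2" by blast+
      qed (rule T2)
      moreover have "p @ [x] \<notin> T" using x(2) by (auto simp: verts_def)
      ultimately show "\<exists>T'. T \<subset> T' \<and> star_tree E T' ?h" by (intro exI[of _ T2]) (auto simp: T1_def T2_def)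
    qed
  qed
  moreover have "m * 2 + N * Suc m > 0" using cT by (simp add: N_def)
  ultimately show ?thesis by blast
qed

section \<open>Infinite complete graphs from infinite branches\<close>

lemma nsets_range_subset:
  fixes f :: "nat \<Rightarrow> 'a"
  assumes "\<And>n. nsets (B \<union> f ` {..<n}) 2 \<subseteq> M"
  shows "nsets (B \<union> range f) 2 \<subseteq> M"
proof
  fix e assume "e \<in> nsets (B \<union> range f) 2"
  then obtain a b where ab: "e = {a, b}" "a \<noteq> b" "a \<in> B \<union> range f" "b \<in> B \<union> range f"
    by (auto simp: nsets_2_eq)
  have "\<exists>n. \<forall>m\<ge>n. v \<in> B \<union> f ` {..<m}" if "v \<in> B \<union> range f" for v
  proof (cases "v \<in> B")
    case False
    then obtain i where "v = f i" using \<open>v \<in> B \<union> range f\<close> by auto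
    then show ?thesis by (intro exI[of _ "Suc i"]) auto
  qed auto
  from this[OF ab(3)] this[OF ab(4)] obtain n n'
    where "\<forall>m\<ge>n. a \<in> B \<union> f ` {..<m}" "\<forall>m\<ge>n'. b \<in> B \<union> f ` {..<m}" by blast
  then have "e \<in> nsets (B \<union> f ` {..<max n n'}) 2" unfolding ab(1) doubleton_in_nsets_2 using ab(2) by simp
  then show "e \<in> M" using assms by blast
qed

theorem rooted_clique_strategy:
  assumes W: "infinite W" "u \<notin> W"
  obtains s where "Maker_strategy s"
    and "\<And>p. play p \<Longrightarrow> Maker_follows s p \<Longrightarrow>
       \<exists>A. infinite A \<and> A \<subseteq> W \<and> nsets (insert u A) 2 \<subseteq> claimed_by_Maker p"
proof -
  have init: "rooted_tree u W {[]} []"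
    by (simp add: rooted_tree_def tree_singleton verts_def nsets_singleton_iff)
  obtain s where s: "Maker_strategy s"
    "\<And>p. play p \<Longrightarrow> Maker_follows s p \<Longrightarrow>
       \<exists>T. \<forall>j. T j \<subset> T (Suc j) \<and> (\<exists>n. rooted_tree u W (T j) (map p [0..<n]))"
    \<comment> \<open>The states are trees, the initial one is the bare root, and each goal is a
      strictly larger tree.\<close>
    using strategy_from_forces[of "rooted_tree u W" "{[]}" "(\<subset>)", OF init rooted_tree_step[OF W]] by blast
  have "\<exists>A. infinite A \<and> A \<subseteq> W \<and> nsets (insert u A) 2 \<subseteq> claimed_by_Maker p"
    if p: "play p" "Maker_follows s p" for p
  proof -
    from s(2)[OF p] obtain T
      where *: "\<forall>j. T j \<subset> T (Suc j) \<and> (\<exists>n. rooted_tree u W (T j) (map p [0..<n]))" ..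
    have T: "T j \<subset> T (Suc j)" "\<exists>n. rooted_tree u W (T j) (map p [0..<n])" for j
      using *[rule_format, of j] by simp_all
    have tree: "tree (T j)" for j using T(2)[of j] by (auto simp: rooted_tree_def)
    obtain f where f: "inj f" "\<And>n. \<exists>j. map f [0..<n] \<in> T j"
      using infinite_branch[of T, OF tree T(1)] by metis
    have n: "f ` {..<n} \<subseteq> W \<and> nsets ({u} \<union> f ` {..<n}) 2 \<subseteq> claimed_by_Maker p" for n
    proof -
      obtain j where j: "map f [0..<n] \<in> T j" using f(2) by blast
      obtain i where i: "rooted_tree u W (T j) (map p [0..<i])" using T(2) by blast
      have f_set: "set (map f [0..<n]) = f ` {..<n}" by (simp add: atLeast0LessThan)
      have "set (map f [0..<n]) \<subseteq> verts (T j)" using j unfolding verts_def by blast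
      moreover have "verts (T j) \<subseteq> W" "nsets (insert u (set (map f [0..<n]))) 2 \<subseteq> maker_edges (map p [0..<i])"
        using i j unfolding rooted_tree_def by blast+
      ultimately show ?thesis using maker_edges_play[of p i] unfolding f_set by auto
    qed
    have "f i \<in> W" for i using n[of "Suc i"] by auto
    then have "range f \<subseteq> W" by blast
    moreover have "nsets ({u} \<union> range f) 2 \<subseteq> claimed_by_Maker p" using nsets_range_subset n by metis
    ultimately show ?thesis using f(1) by (intro exI[of _ "range f"]) (auto simp: range_inj_infinite)
  qed
  with s(1) show ?thesis by (rule that)
qed

text \<open>Nodes on the branch are its initial segments, so the pairs at positions
  \<open>2 * k\<close> and \<open>Suc (2 * k)\<close> of the nodes are the same pairs of the
  branch.\<close>

theorem star_clique_strategy: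
  assumes stars: "star_rich E"
  obtains s where "Maker_strategy s"
    and "\<And>p. play p \<Longrightarrow> Maker_follows s p \<Longrightarrow>
       \<exists>f. inj f \<and> nsets (range f) 2 \<subseteq> claimed_by_Maker p \<and> (\<forall>k. E (f (2 * k)) (f (Suc (2 * k))))"
proof -
  have init: "star_tree E {[]} []"
    by (simp add: star_tree_def tree_singleton nsets_empty_iff)
  obtain s where s: "Maker_strategy s"
    "\<And>p. play p \<Longrightarrow> Maker_follows s p \<Longrightarrow>
       \<exists>T. \<forall>j. T j \<subset> T (Suc j) \<and> (\<exists>n. star_tree E (T j) (map p [0..<n]))"
    using strategy_from_forces[of "star_tree E" "{[]}" "(\<subset>)", OF init star_tree_step[OF stars]] by blast
  have "\<exists>f. inj f \<and> nsets (range f) 2 \<subseteq> claimed_by_Maker p \<and> (\<forall>k. E (f (2 * k)) (f (Suc (2 * k))))"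
    if p: "play p" "Maker_follows s p" for p
  proof -
    from s(2)[OF p] obtain T
      where *: "\<forall>j. T j \<subset> T (Suc j) \<and> (\<exists>n. star_tree E (T j) (map p [0..<n]))" ..
    have T: "T j \<subset> T (Suc j)" "\<exists>n. star_tree E (T j) (map p [0..<n])" for j
      using *[rule_format, of j] by simp_all
    have tree: "tree (T j)" for j using T(2)[of j] by (auto simp: star_tree_def)
    obtain f where f: "inj f" "\<And>n. \<exists>j. map f [0..<n] \<in> T j"
      using infinite_branch[of T, OF tree T(1)] by metis
    have n: "nsets ({} \<union> f ` {..<n}) 2 \<subseteq> claimed_by_Maker p \<and>
        (\<forall>k. Suc (2 * k) < n \<longrightarrow> E (f (2 * k)) (f (Suc (2 * k))))" for n
    proof -
      obtain j where j: "map f [0..<n] \<in> T j" using f(2) by blast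
      obtain i where i: "star_tree E (T j) (map p [0..<i])" using T(2) by blast
      have f_set: "set (map f [0..<n]) = f ` {..<n}" by (simp add: atLeast0LessThan)
      have "nsets (set (map f [0..<n])) 2 \<subseteq> maker_edges (map p [0..<i])"
        using i j unfolding star_tree_def by blast
      moreover have "E (f (2 * k)) (f (Suc (2 * k)))" if "Suc (2 * k) < n" for k
        using i j that unfolding star_tree_def by fastforce
      ultimately show ?thesis using maker_edges_play[of p i] unfolding f_set by auto
    qed
    have "nsets ({} \<union> range f) 2 \<subseteq> claimed_by_Maker p" using nsets_range_subset n by metis
    with n f(1) show ?thesis by auto
  qed
  with s(1) show ?thesis by (rule that)
qed

section \<open>Colour classes\<close>

definition nbrs :: "(edge \<Rightarrow> nat) \<Rightarrow> nat \<Rightarrow> nat \<Rightarrow> nat set" where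
  "nbrs c i v = {w. w \<noteq> v \<and> c {v, w} = i}"

definition homogeneous :: "(edge \<Rightarrow> nat) \<Rightarrow> nat \<Rightarrow> nat set \<Rightarrow> bool" where
  "homogeneous c i H \<longleftrightarrow> (\<forall>x\<in>H. \<forall>y\<in>H. x \<noteq> y \<longrightarrow> c {x, y} = i)"

lemma nbrs_sym: "w \<in> nbrs c i v \<longleftrightarrow> v \<in> nbrs c i w"
  by (auto simp: nbrs_def insert_commute)

lemma incident_edges_color_class:
  "incident_edges (color_class c i) v = (\<lambda>w. {v, w}) ` nbrs c i v"
  unfolding incident_edges_def color_class_def edges_B_def nbrs_def
  by (auto simp: nsets_2_eq insert_commute)

lemma inj_on_doubleton: "inj_on (\<lambda>w. {v, w}) A"
  by (auto simp: inj_on_def doubleton_eq_iff)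

lemma Union_color_class: "v \<in> \<Union> (color_class c i) \<longleftrightarrow> nbrs c i v \<noteq> {}"
  using incident_edges_color_class[of c i v] unfolding incident_edges_def by auto

text \<open>A vertex outside the induced graph has no neighbours of the colour and satisfies any
  bound, so all vertices may be quantified over.\<close>

lemma finite_max_degree_iff:
  "finite_max_degree (color_class c i) \<longleftrightarrow> (\<exists>d. \<forall>v. finite (nbrs c i v) \<and> card (nbrs c i v) \<le> d)"
  unfolding finite_max_degree_def incident_edges_color_class Ball_def Union_color_class
  by (auto simp: card_image inj_on_doubleton finite_image_iff) (metis card.empty finite.emptyI le0)+

lemma doubleton_in_color_class: "{x, y} \<in> color_class c i \<longleftrightarrow> y \<in> nbrs c i x"
  by (auto simp: color_class_def edges_B_def nbrs_def)

lemma infinite_homogeneous_edges: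
  assumes "homogeneous c i H" "infinite H" "H \<subseteq> A"
  shows "infinite (color_class c i \<inter> nsets A 2)"
proof -
  have "infinite (nsets H 2)" using assms by (intro infinite_imp_infinite_nsets) simp_all
  moreover have "nsets H 2 \<subseteq> color_class c i \<inter> nsets A 2"
  proof
    fix e assume "e \<in> nsets H 2"
    then obtain x y where "e = {x, y}" "x \<in> H" "y \<in> H" "x \<noteq> y" by (auto simp: nsets_2_eq)
    with assms(1,3) show "e \<in> color_class c i \<inter> nsets A 2"
      by (auto simp: doubleton_in_color_class nbrs_def homogeneous_def)
  qed
  ultimately show ?thesis using finite_subset by blast
qed

lemma exists_homogeneous:
  assumes c: "c \<in> edges_B \<rightarrow> {1..2}" and "infinite A"
  obtains i H where "i \<in> {1, 2}" "infinite H" "H \<subseteq> A" "homogeneous c i H"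
proof -
  have c12: "c {x, y} \<in> {1, 2}" if "x \<noteq> y" for x y
  proof -
    have "{x, y} \<in> edges_B" using that by (simp add: edges_B_def)
    then have "c {x, y} \<in> {1..2}" using c by blast
    then show ?thesis by auto
  qed
  then have "\<forall>x\<in>A. \<forall>y\<in>A. x \<noteq> y \<longrightarrow> c {x, y} < 3" by force
  from Ramsey2[OF \<open>infinite A\<close> this] obtain H t
    where H: "H \<subseteq> A" "infinite H" "\<forall>x\<in>H. \<forall>y\<in>H. x \<noteq> y \<longrightarrow> c {x, y} = t" by blast
  \<comment> \<open>Two distinct points of \<open>H\<close> show that the colour \<open>t\<close> is
    actually attained, which excludes 0.\<close>
  obtain x where "x \<in> H" using H(2) by fastforce
  moreover obtain y where "y \<in> H - {x}" using H(2) by (metis all_not_in_conv finite.emptyI infinite_remove)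
  ultimately have "t \<in> {1, 2}" using H(3) c12[of x y] by auto
  with H that show ?thesis by (auto simp: homogeneous_def)
qed

section \<open>Maker's win when both colours have unbounded degrees\<close>

text \<open>Here the stars only steer the branch: its even vertices lie in \<open>H1\<close> and its
  odd ones in \<open>H2\<close>, so it contains an infinite homogeneous set of either
  colour.\<close>

lemma Maker_wins_two_homogeneous:
  assumes H: "infinite H1" "homogeneous c 1 H1" "infinite H2" "homogeneous c 2 H2"
  shows "Maker_has_winning_strategy 2 c"
proof -
  have stars: "star_rich (\<lambda>x y. x \<in> H1 \<and> y \<in> H2)"
    unfolding star_rich_def
  proof (intro allI impI)
    fix F :: "nat set" and q :: nat
    assume F: "finite F"
    obtain x where x: "x \<in> H1 - F"
      using Diff_infinite_finite[OF F H(1)] by (metis all_not_in_conv finite.emptyI)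
    have "infinite (H2 - insert x F)" using F H(3) by (simp add: Diff_infinite_finite)
    then obtain Y where "finite Y" "card Y = q" "Y \<subseteq> H2 - insert x F"
      using infinite_arbitrarily_large by blast
    with x show "\<exists>x Y. x \<notin> F \<and> finite Y \<and> q \<le> card Y \<and> x \<notin> Y \<and> Y \<inter> F = {} \<and>
        (\<forall>y\<in>Y. x \<in> H1 \<and> y \<in> H2)"
      by (intro exI[of _ x] exI[of _ Y]) auto
  qed
  obtain s where s: "Maker_strategy s" "\<And>p. play p \<Longrightarrow> Maker_follows s p \<Longrightarrow>
      \<exists>f. inj f \<and> nsets (range f) 2 \<subseteq> claimed_by_Maker p \<and> (\<forall>k. f (2 * k) \<in> H1 \<and> f (Suc (2 * k)) \<in> H2)"
    using star_clique_strategy[of "\<lambda>x y. x \<in> H1 \<and> y \<in> H2"] stars by blast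
  have "Maker_wins_play 2 c p" if p: "play p" "Maker_follows s p" for p
  proof -
    from s(2)[OF p] obtain f where f: "inj f" "nsets (range f) 2 \<subseteq> claimed_by_Maker p"
      "\<And>k. f (2 * k) \<in> H1" "\<And>k. f (Suc (2 * k)) \<in> H2" by blast
    have "inj (\<lambda>k. f (2 * k))" "inj (\<lambda>k. f (Suc (2 * k)))"
      by (rule injI, drule injD[OF f(1)], simp)+
    then have inf: "infinite (range (\<lambda>k. f (2 * k)))" "infinite (range (\<lambda>k. f (Suc (2 * k))))"
      by (simp_all add: range_inj_infinite)
    have "infinite (color_class c 1 \<inter> nsets (range f) 2)"
      by (rule infinite_homogeneous_edges[OF _ inf(1)]) (use H f(3) in \<open>auto simp: homogeneous_def\<close>)
    moreover have "infinite (color_class c 2 \<inter> nsets (range f) 2)"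
      by (rule infinite_homogeneous_edges[OF _ inf(2)]) (use H f(4) in \<open>auto simp: homogeneous_def\<close>)
    moreover have "{1..2} = {1, 2 :: nat}" by auto
    ultimately show ?thesis
      unfolding Maker_wins_play_def using f(1,2)
      by (intro exI[of _ "range f"]) (simp add: range_inj_infinite)
  qed
  with s(1) show ?thesis unfolding Maker_has_winning_strategy_def by blast
qed

lemma infinite_color_edges_strategy:
  assumes "\<not> finite_max_degree (color_class c i)"
  obtains s where "Maker_strategy s"
    and "\<And>p. play p \<Longrightarrow> Maker_follows s p \<Longrightarrow>
       \<exists>A. infinite A \<and> nsets A 2 \<subseteq> claimed_by_Maker p \<and> infinite (color_class c i \<inter> nsets A 2)"
proof (cases "\<exists>u. infinite (nbrs c i u)")
  case True
  then obtain u where u: "infinite (nbrs c i u)" by blast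
  have "u \<notin> nbrs c i u" by (simp add: nbrs_def)
  with u obtain s where s: "Maker_strategy s" "\<And>p. play p \<Longrightarrow> Maker_follows s p \<Longrightarrow>
      \<exists>A. infinite A \<and> A \<subseteq> nbrs c i u \<and> nsets (insert u A) 2 \<subseteq> claimed_by_Maker p"
    using rooted_clique_strategy by blast
  show ?thesis
  proof (rule that[OF s(1)])
    fix p assume "play p" "Maker_follows s p"
    from s(2)[OF this] obtain A where A: "infinite A" "A \<subseteq> nbrs c i u"
      "nsets (insert u A) 2 \<subseteq> claimed_by_Maker p" by blast
    have "(\<lambda>w. {u, w}) ` A \<subseteq> color_class c i \<inter> nsets (insert u A) 2"
      using A(2) by (auto simp: doubleton_in_color_class nbrs_def)
    moreover have "infinite ((\<lambda>w. {u, w}) ` A)"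
      using A(1) by (simp add: finite_image_iff inj_on_doubleton)
    ultimately have "infinite (color_class c i \<inter> nsets (insert u A) 2)" using finite_subset by blast
    with A show "\<exists>A. infinite A \<and> nsets A 2 \<subseteq> claimed_by_Maker p \<and> infinite (color_class c i \<inter> nsets A 2)"
      by (intro exI[of _ "insert u A"]) simp
  qed
next
  case False
  then have fin: "finite (nbrs c i v)" for v by blast
  with assms have big: "\<exists>v. d < card (nbrs c i v)" for d
    unfolding finite_max_degree_iff by (metis not_le)
  have stars: "star_rich (\<lambda>x y. y \<in> nbrs c i x)"
    unfolding star_rich_def
  proof (intro allI impI)
    fix F :: "nat set" and q :: nat
    assume F: "finite F"
    \<comment> \<open>A degree above the sum of the degrees in \<open>F\<close> forces
      \<open>x\<close> outside \<open>F\<close>; the summand \<open>card F\<close> leaves enough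
      neighbours after \<open>F\<close> is removed.\<close>
    obtain x where x: "q + card F + (\<Sum>v\<in>F. card (nbrs c i v)) < card (nbrs c i x)" using big by blast
    then have "x \<notin> F" using member_le_sum[of x F "\<lambda>v. card (nbrs c i v)"] F by auto
    moreover have "q \<le> card (nbrs c i x - F)" using x diff_card_le_card_Diff[OF F, of "nbrs c i x"] by simp
    ultimately show "\<exists>x Y. x \<notin> F \<and> finite Y \<and> q \<le> card Y \<and> x \<notin> Y \<and> Y \<inter> F = {} \<and>
        (\<forall>y\<in>Y. y \<in> nbrs c i x)"
      using fin by (intro exI[of _ x] exI[of _ "nbrs c i x - F"]) (auto simp: nbrs_def)
  qed
  obtain s where s: "Maker_strategy s" "\<And>p. play p \<Longrightarrow> Maker_follows s p \<Longrightarrow>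
      \<exists>f. inj f \<and> nsets (range f) 2 \<subseteq> claimed_by_Maker p \<and> (\<forall>k. f (Suc (2 * k)) \<in> nbrs c i (f (2 * k)))"
    using star_clique_strategy[of "\<lambda>x y. y \<in> nbrs c i x"] stars by blast
  show ?thesis
  proof (rule that[OF s(1)])
    fix p assume "play p" "Maker_follows s p"
    from s(2)[OF this] obtain f where f: "inj f" "nsets (range f) 2 \<subseteq> claimed_by_Maker p"
      "\<And>k. f (Suc (2 * k)) \<in> nbrs c i (f (2 * k))" by blast
    let ?e = "\<lambda>k. {f (2 * k), f (Suc (2 * k))}"
    have "inj ?e"
    proof (rule injI)
      fix k l assume "?e k = ?e l"
      then have "2 * k = 2 * l \<or> 2 * k = Suc (2 * l)" using f(1) by (auto simp: doubleton_eq_iff inj_eq)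
      then show "k = l" by presburger
    qed
    then have "infinite (range ?e)" by (rule range_inj_infinite)
    moreover have "range ?e \<subseteq> color_class c i \<inter> nsets (range f) 2"
      using f(1,3) by (auto simp: doubleton_in_color_class inj_eq)
    ultimately have "infinite (color_class c i \<inter> nsets (range f) 2)" using finite_subset by blast
    with f show "\<exists>A. infinite A \<and> nsets A 2 \<subseteq> claimed_by_Maker p \<and> infinite (color_class c i \<inter> nsets A 2)"
      by (intro exI[of _ "range f"]) (simp add: range_inj_infinite)
  qed
qed

theorem Maker_wins_unbounded_degrees:
  assumes c: "c \<in> edges_B \<rightarrow> {1..2}"
    and unbounded: "\<not> finite_max_degree (color_class c 1)" "\<not> finite_max_degree (color_class c 2)"
  shows "Maker_has_winning_strategy 2 c"
proof (cases "\<forall>i\<in>{1, 2}. \<exists>H. infinite H \<and> homogeneous c i H")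
  case True
  then show ?thesis using Maker_wins_two_homogeneous by auto
next
  case False
  then obtain i where i: "i \<in> {1, 2}" "\<And>H. infinite H \<Longrightarrow> \<not> homogeneous c i H" by blast
  \<comment> \<open>Ramsey's theorem inside \<open>A\<close> cannot yield colour \<open>i\<close>,
    so it yields the other one.\<close>
  have other: "infinite (color_class c j \<inter> nsets A 2)" if "infinite A" "j \<in> {1..2}" "j \<noteq> i" for j A
  proof -
    obtain k H where H: "k \<in> {1, 2}" "infinite H" "H \<subseteq> A" "homogeneous c k H"
      using exists_homogeneous[OF c \<open>infinite A\<close>] by blast
    then have "k \<noteq> i" using i(2) by blast
    then have "k = j" using H(1) i(1) that(2,3) by auto
    then show ?thesis using infinite_homogeneous_edges H by blast
  qed
  have "\<not> finite_max_degree (color_class c i)" using i(1) unbounded by auto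
  then obtain s where s: "Maker_strategy s" "\<And>p. play p \<Longrightarrow> Maker_follows s p \<Longrightarrow>
      \<exists>A. infinite A \<and> nsets A 2 \<subseteq> claimed_by_Maker p \<and> infinite (color_class c i \<inter> nsets A 2)"
    using infinite_color_edges_strategy by blast
  have "Maker_wins_play 2 c p" if "play p" "Maker_follows s p" for p
    using s(2)[OF that] other unfolding Maker_wins_play_def by metis
  with s(1) show ?thesis unfolding Maker_has_winning_strategy_def by blast
qed

section \<open>Breaker's win against a colour of bounded degree\<close>

text \<open>Labels are chosen in the order of the vertices; at most \<open>d\<close> of the
  \<open>d + 1\<close> labels are forbidden at each vertex. For a symmetric relation
  \<open>C\<close> this separates any two distinct related vertices.\<close>

lemma greedy_coloring:
  fixes C :: "nat \<Rightarrow> nat set"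
  assumes "\<And>v. finite (C v) \<and> card (C v) \<le> d"
  shows "\<exists>lab :: nat \<Rightarrow> nat. \<forall>v. lab v \<le> d \<and> (\<forall>w\<in>C v. w < v \<longrightarrow> lab v \<noteq> lab w)"
proof (rule dependent_wellorder_choice)
  fix v and lab :: "nat \<Rightarrow> nat"
  have "card (lab ` C v) \<le> d" using assms[of v] card_image_le le_trans by blast
  then have "\<not> {..d} \<subseteq> lab ` C v" using card_mono[of "lab ` C v" "{..d}"] assms by fastforce
  then show "\<exists>r. r \<le> d \<and> (\<forall>w\<in>C v. w < v \<longrightarrow> r \<noteq> lab w)" by blast
qed auto

theorem Breaker_wins_bounded_degree:
  assumes "finite_max_degree (color_class c i)" "i \<in> {1..k}"
  shows "Breaker_has_winning_strategy k c"
proof -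
  let ?N = "nbrs c i"
  obtain d where d: "\<And>v. finite (?N v) \<and> card (?N v) \<le> d"
    using assms(1) unfolding finite_max_degree_iff by blast
  \<comment> \<open>The ends of walks of length two from \<open>v\<close>, at most
    \<open>d * d\<close> of them. \<open>v\<close> itself may occur, but the labelling compares it
    with smaller vertices only.\<close>
  define C where "C v = (\<Union>u\<in>?N v. ?N u)" for v
  have "finite (C v) \<and> card (C v) \<le> d * d" for v
  proof -
    have "card (C v) \<le> (\<Sum>u\<in>?N v. card (?N u))" unfolding C_def by (rule card_UN_le) (use d in blast)
    also have "\<dots> \<le> card (?N v) * d" using sum_bounded_above[of "?N v" "\<lambda>u. card (?N u)" d] d by simp
    also have "\<dots> \<le> d * d" using d by simp
    finally show ?thesis using d by (auto simp: C_def)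
  qed
  from greedy_coloring[of C "d * d", OF this] obtain lab :: "nat \<Rightarrow> nat"
    where *: "\<forall>v. lab v \<le> d * d \<and> (\<forall>w\<in>C v. w < v \<longrightarrow> lab v \<noteq> lab w)" ..
  have lab: "lab v \<le> d * d" "w \<in> C v \<Longrightarrow> w < v \<Longrightarrow> lab v \<noteq> lab w" for v w
    using *[rule_format, of v] by simp_all
  have uniq: "v = w" if "v \<in> ?N u" "w \<in> ?N u" "lab v = lab w" for u v w
  proof -
    have "w \<in> C v" "v \<in> C w" using that nbrs_sym unfolding C_def by blast+
    with lab(2)[of w v] lab(2)[of v w] that(3) show ?thesis by (metis nat_neq_iff)
  qed
  \<comment> \<open>A partial pairing: an edge has no partner if \<open>x'\<close> or
    \<open>y'\<close> does not exist. An edge of colour \<open>i\<close> is its own partner.\<close>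
  define R where "R e e' \<longleftrightarrow> (\<exists>x y x' y'. e = {x, y} \<and> e' = {x', y'} \<and> x \<noteq> y \<and>
      x' \<in> ?N x \<and> y' \<in> ?N y \<and> lab x' = lab y \<and> lab y' = lab x)" for e e'
  have R_sym: "R e' e" if "R e e'" for e e'
  proof -
    from that obtain x y x' y' where *: "e = {x, y}" "e' = {x', y'}" "x \<noteq> y"
      "x' \<in> ?N x" "y' \<in> ?N y" "lab x' = lab y" "lab y' = lab x" unfolding R_def by blast
    have "x \<in> ?N x'" "y \<in> ?N y'" using *(4,5) nbrs_sym by blast+
    \<comment> \<open>Otherwise \<open>x\<close> and \<open>y\<close> would be neighbours of
      \<open>x'\<close> with equal labels.\<close>
    moreover from this have "x' \<noteq> y'" using *(3,6,7) uniq[of x x' y] by auto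
    ultimately show ?thesis
      unfolding R_def using *
      by (intro exI[of _ x'] exI[of _ y'] exI[of _ x] exI[of _ y]) simp
  qed
  have R_fun: "e' = e''" if "R e e'" "R e e''" for e e' e''
  proof -
    from that(1) obtain x y x' y' where *: "e = {x, y}" "e' = {x', y'}"
      "x' \<in> ?N x" "y' \<in> ?N y" "lab x' = lab y" "lab y' = lab x" unfolding R_def by blast
    from that(2) obtain u v u' v' where **: "e = {u, v}" "e'' = {u', v'}"
      "u' \<in> ?N u" "v' \<in> ?N v" "lab u' = lab v" "lab v' = lab u" unfolding R_def by blast
    from *(1) **(1) consider "u = x" "v = y" | "u = y" "v = x" by (auto simp: doubleton_eq_iff)
    then show ?thesis
    proof cases
      case 1
      then have "u' = x'" "v' = y'" using * ** uniq[of u' x x'] uniq[of v' y y'] by auto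
      then show ?thesis using * ** by simp
    next
      case 2
      then have "u' = y'" "v' = x'" using * ** uniq[of u' y y'] uniq[of v' x x'] by auto
      then show ?thesis using * ** by (simp add: insert_commute)
    qed
  qed
  obtain s where s: "Breaker_strategy s"
    "\<And>p e e'. play p \<Longrightarrow> Breaker_follows s p \<Longrightarrow> R e e' \<Longrightarrow> e \<noteq> e' \<Longrightarrow> \<not> {e, e'} \<subseteq> claimed_by_Maker p"
    using pairing_strategy[of R] R_sym R_fun by metis
  have "\<not> Maker_wins_play k c p" if p: "play p" "Breaker_follows s p" for p
  proof
    assume "Maker_wins_play k c p"
    then obtain A where A: "nsets A 2 \<subseteq> claimed_by_Maker p"
      "\<forall>i\<in>{1..k}. infinite (color_class c i \<inter> nsets A 2)"
      unfolding Maker_wins_play_def by blast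
    have inf: "infinite (color_class c i \<inter> nsets A 2)" using A(2) assms(2) by blast
    \<comment> \<open>\<open>Min\<close> and \<open>Max\<close> order the ends of an edge. There are
      finitely many pairs of labels, so two of the infinitely many edges of colour \<open>i\<close>
      agree in both labels.\<close>
    let ?L = "\<lambda>e. (lab (Min e), lab (Max e))"
    have "?L ` (color_class c i \<inter> nsets A 2) \<subseteq> {..d * d} \<times> {..d * d}" using lab(1) by auto
    then have "finite (?L ` (color_class c i \<inter> nsets A 2))" by (rule finite_subset) simp
    then have "\<not> inj_on ?L (color_class c i \<inter> nsets A 2)" using inf finite_imageD by blast
    then obtain e e' where e: "e \<in> color_class c i \<inter> nsets A 2" "e' \<in> color_class c i \<inter> nsets A 2"
      "e \<noteq> e'" "?L e = ?L e'" unfolding inj_on_def by blast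
    have ends: "f = {Min f, Max f} \<and> Min f \<in> A \<and> Max f \<in> A \<and> Max f \<in> ?N (Min f)"
      if "f \<in> color_class c i \<inter> nsets A 2" for f
    proof -
      from that obtain a b where ab: "f = {a, b}" "a \<in> A" "b \<in> A" "a < b"
        unfolding ordered_nsets_2_eq by blast
      then have "Min f = a" "Max f = b" by auto
      with ab that show ?thesis using doubleton_in_color_class by auto
    qed
    obtain x x' y y' where xy: "x = Min e" "x' = Max e" "y = Min e'" "y' = Max e'" by blast
    note ends_e = ends[OF e(1), folded xy] and ends_e' = ends[OF e(2), folded xy]
    have E: "e = {x, x'}" "e' = {y, y'}" "x \<in> A" "x' \<in> A" "y \<in> A" "y' \<in> A"
      "x' \<in> ?N x" "y' \<in> ?N y"
      using ends_e ends_e' by blast+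
    have labs: "lab x = lab y" "lab x' = lab y'" using e(4) by (simp_all add: xy)
    have sym: "x \<in> ?N x'" "y \<in> ?N y'" using E(7,8) nbrs_sym by blast+
    \<comment> \<open>If the two edges shared an end, their other ends would be neighbours of it
      with equal labels, so the edges would coincide.\<close>
    have "x \<noteq> y" using uniq[of x' x y'] E labs(2) \<open>e \<noteq> e'\<close> by metis
    have "x \<noteq> y'" using uniq[of x' x y] E sym labs \<open>e \<noteq> e'\<close> by (metis insert_commute)
    have "x' \<noteq> y" using uniq[of x x' y'] E sym labs \<open>e \<noteq> e'\<close> by (metis insert_commute)
    \<comment> \<open>\<open>x'\<close> is the neighbour of \<open>x\<close> labelled like
      \<open>y'\<close>, and \<open>y\<close> is the neighbour of \<open>y'\<close> labelled like
      \<open>x\<close>. So the cross edges are partners, yet both lie in Maker's complete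
      graph.\<close>
    have "R {x, y'} {x', y}"
      unfolding R_def using E(7) sym(2) labs \<open>x \<noteq> y'\<close> by metis
    moreover have "{x, y'} \<noteq> {x', y}"
      using \<open>x \<noteq> y\<close> E(7) by (simp add: doubleton_eq_iff nbrs_def)
    moreover have "{{x, y'}, {x', y}} \<subseteq> claimed_by_Maker p"
      using A(1) E(3-6) \<open>x \<noteq> y'\<close> \<open>x' \<noteq> y\<close> by (simp add: subset_iff)
    ultimately show False using s(2)[OF p] by blast
  qed
  with s(1) show ?thesis unfolding Breaker_has_winning_strategy_def by blast
qed

section \<open>The two cases together\<close>

theorem theorem1p1:
  fixes c :: "edge \<Rightarrow> nat"
  assumes "c \<in> edges_B \<rightarrow> {1..2}"
  shows "(finite_max_degree (color_class c 1) \<or> finite_max_degree (color_class c 2)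
            \<longrightarrow> Breaker_has_winning_strategy 2 c)
       \<and> (\<not> (finite_max_degree (color_class c 1) \<or> finite_max_degree (color_class c 2))
            \<longrightarrow> Maker_has_winning_strategy 2 c)"
proof (intro conjI impI)
  assume "finite_max_degree (color_class c 1) \<or> finite_max_degree (color_class c 2)"
  then show "Breaker_has_winning_strategy 2 c"
  proof
    assume "finite_max_degree (color_class c 1)"
    then show ?thesis by (rule Breaker_wins_bounded_degree) simp
  next
    assume "finite_max_degree (color_class c 2)"
    then show ?thesis by (rule Breaker_wins_bounded_degree) simp
  qed
next
  assume "\<not> (finite_max_degree (color_class c 1) \<or> finite_max_degree (color_class c 2))"
  then show "Maker_has_winning_strategy 2 c"
    using Maker_wins_unbounded_degrees[OF assms] by blast
qed

end
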